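(* Let $K\subset\mathbb{R}^n$ be a nonempty closed convex set, let $P:\mathbb{R}^n\to\mathbb{R}^n$ be a polynomial map of degree $d$, where $d$ is a positive integer, and let $\mathcal{S}:=\mathrm{SOL}(K^\infty,P^\infty)$. Assume that $K$ is semi-algebraic, $0\in K$, and $P$ is copositive on $K$. If $p\in\mathrm{int}(\mathcal{S}^* )$, then the set-valued map $\mathrm{SOL}_P:\mathbb{R}^n\rightrightarrows\mathbb{R}^n$, $q\mapsto\mathrm{SOL}(K,P+q)$, is locally upper-Hölder stable at $p$.
   Context: For a nonempty closed convex set $K\subset\mathbb{R}^n$ and a continuous map $F:\mathbb{R}^n\to\mathbb{R}^n$, $\mathrm{SOL}(K,F)$ denotes the set of $x\in K$ such that $\langle F(x),y-x\rangle\ge 0$ for all $y\in K$. For $q\in\mathbb{R}^n$, $P+q$ denotes the map $x\mapsto P(x)+q$. The asymptotic cone of $K$ is $K^\infty=\{v\in\mathbb{R}^n:\exists t_k\to\infty,\ \exists x_k\in K,\ x_k/t_k\to v\}$ (the recession cone of $K$). For a polynomial map $P=(P_1,\dots,P_n)$, its degree is $d=\max_l\deg P_l$, and $P^\infty=(P_1^\infty,\dots,P_n^\infty)$, where $P_l^\infty$ is the homogeneous component of degree $d$ of $P_l$. A map $F$ is copositive on $K$ if $\langle F(x),x\rangle\ge 0$ for all $x\in K$. For a cone $C\subset\mathbb{R}^n$ (not necessarily convex), $C^*=\{q\in\mathbb{R}^n:\langle q,v\rangle\ge 0\ \forall v\in C\}$ and $\mathrm{int}$ denotes interior. A subset of $\mathbb{R}^n$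 is semi-algebraic if it is a finite union of sets each defined by finitely many polynomial equations and strict polynomial inequalities. The map $\mathrm{SOL}_P$ is locally upper-Hölder stable at $p$ if there exist $L>0$, $c>0$ and a neighborhood $U_p$ of $p$ such that $\mathrm{SOL}_P(q)\subset\mathrm{SOL}_P(p)+L\|q-p\|^c\,\mathbb{B}(0,1)$ for all $q\in U_p$, where $\mathbb{B}(0,1)$ is the closed unit ball in $\mathbb{R}^n$. *)

theory Defs
  imports "HOL-Analysis.Analysis" "HOL-Library.Poly_Mapping"
begin

text \<open>
  Real polynomials in variables indexed by \<open>'n\<close>: a monomial is its exponent function,
  a polynomial its finitely supported coefficient function. Over the reals a polynomial
  is determined by the function it induces, so a polynomial map is represented by its
  vector of polynomials.
\<close>

type_synonym 'n rpoly = "('n \<Rightarrow>\<^sub>0 nat) \<Rightarrow>\<^sub>0 real"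

definition monom_degree :: "('n::finite \<Rightarrow>\<^sub>0 nat) \<Rightarrow> nat" where
  "monom_degree m = (\<Sum>i\<in>UNIV. Poly_Mapping.lookup m i)"

definition eval_rpoly :: "'n::finite rpoly \<Rightarrow> real ^ 'n \<Rightarrow> real" where
  "eval_rpoly f x =
    (\<Sum>m\<in>Poly_Mapping.keys f.
      Poly_Mapping.lookup f m * (\<Prod>i\<in>UNIV. (x $ i) ^ Poly_Mapping.lookup m i))"

text \<open>The zero polynomial is given degree 0.\<close>

definition rpoly_degree :: "'n::finite rpoly \<Rightarrow> nat" where
  "rpoly_degree f = Max (insert 0 (monom_degree ` Poly_Mapping.keys f))"

definition hom_component :: "nat \<Rightarrow> 'n::finite rpoly \<Rightarrow> 'n rpoly" where
  "hom_component k f =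
    (\<Sum>m\<in>{m \<in> Poly_Mapping.keys f. monom_degree m = k}.
      Poly_Mapping.single m (Poly_Mapping.lookup f m))"

definition polymap :: "'n::finite rpoly ^ 'n \<Rightarrow> real ^ 'n \<Rightarrow> real ^ 'n" where
  "polymap P x = (\<chi> l. eval_rpoly (P $ l) x)"

definition polymap_degree :: "'n::finite rpoly ^ 'n \<Rightarrow> nat" where
  "polymap_degree P = Max (range (\<lambda>l. rpoly_degree (P $ l)))"

text \<open>
  All components are truncated at the degree of the whole map, so a component of smaller
  degree contributes 0.
\<close>

definition leading_part :: "'n::finite rpoly ^ 'n \<Rightarrow> 'n rpoly ^ 'n" where
  "leading_part P = (\<chi> l. hom_component (polymap_degree P) (P $ l))"

definition semialgebraic :: "(real ^ 'n::finite) set \<Rightarrow> bool" where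
  "semialgebraic S \<longleftrightarrow>
    (\<exists>\<C> :: ('n rpoly set \<times> 'n rpoly set) set.
      finite \<C> \<and> (\<forall>(E, G)\<in>\<C>. finite E \<and> finite G) \<and>
      S = (\<Union>(E, G)\<in>\<C>. {x. (\<forall>f\<in>E. eval_rpoly f x = 0) \<and> (\<forall>g\<in>G. eval_rpoly g x > 0)}))"

definition SOL :: "(real ^ 'n::finite) set \<Rightarrow> (real ^ 'n \<Rightarrow> real ^ 'n) \<Rightarrow> (real ^ 'n) set" where
  "SOL K F = {x \<in> K. \<forall>y\<in>K. F x \<bullet> (y - x) \<ge> 0}"

definition asymptotic_cone :: "(real ^ 'n::finite) set \<Rightarrow> (real ^ 'n) set" where
  "asymptotic_cone K =
    {v. \<exists>(t :: nat \<Rightarrow> real) x. filterlim t at_top sequentially \<and> (\<forall>k. x k \<in> K) \<and>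
      (\<lambda>k. x k /\<^sub>R t k) \<longlonglongrightarrow> v}"

definition copositive_on :: "(real ^ 'n::finite) set \<Rightarrow> (real ^ 'n \<Rightarrow> real ^ 'n) \<Rightarrow> bool" where
  "copositive_on K F \<longleftrightarrow> (\<forall>x\<in>K. F x \<bullet> x \<ge> 0)"

definition dual_cone :: "(real ^ 'n::finite) set \<Rightarrow> (real ^ 'n) set" where
  "dual_cone C = {q. \<forall>v\<in>C. q \<bullet> v \<ge> 0}"

definition locally_upper_Hoelder_stable ::
  "(real ^ 'n::finite \<Rightarrow> (real ^ 'n) set) \<Rightarrow> real ^ 'n \<Rightarrow> bool" where
  "locally_upper_Hoelder_stable \<Phi> p \<longleftrightarrow>
    (\<exists>L>0. \<exists>c>0. \<exists>U. open U \<and> p \<in> U \<and>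
      (\<forall>q\<in>U. \<Phi> q \<subseteq>
        {x + (L * norm (q - p) powr c) *\<^sub>R b | x b. x \<in> \<Phi> p \<and> b \<in> cball 0 1}))"

end

theory Submission
  imports Defs "HOL-Computational_Algebra.Polynomial"
begin

text \<open>
  The theorem combines a compactness argument with semialgebraic geometry.

  First, solutions do not escape to infinity when the parameter tends to \<open>p\<close>: a limit
  direction \<open>v\<close> of unbounded solutions would solve the homogeneous problem on the
  asymptotic cone, so that \<open>p \<bullet> v > 0\<close> because \<open>p\<close> is interior
  to the dual cone, whereas copositivity forces \<open>p \<bullet> v \<le> 0\<close>
  (\<open>SOL_locally_bounded\<close>). By compactness the solution map is then upper
  semicontinuous at \<open>p\<close> (\<open>SOL_upper_semicontinuous\<close>).

  Secondly, for semialgebraic data qualitative continuity is already of Hoelder type. Let \<open>G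
  s t\<close> say that a solution for some parameter within squared distance \<open>t\<close> of
  \<open>p\<close> has squared distance at least \<open>s\<close> to all solutions for
  \<open>p\<close>. The definition of \<open>G\<close> is a first-order formula over the ordered
  field of the reals, so by quantifier elimination \<open>G s t\<close> depends only on the signs
  of finitely many polynomials in \<open>s\<close> and \<open>t\<close>. Such signs are constant
  on the region \<open>0 < t < s\<^sup>N\<close>, \<open>0 < s < 1/N\<close> for large
  \<open>N\<close>, because there the lowest coefficient with respect to \<open>t\<close>
  dominates (\<open>definable_constant_on_corner\<close>). Upper semicontinuity says that \<open>G
  s t\<close> fails for fixed \<open>s\<close> and small \<open>t\<close>, hence it fails on the
  whole region, which is the Hoelder estimate with exponent \<open>1/N\<close>
  (\<open>SOL_hoelder_of_upper_semicontinuous\<close>).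

  Quantifier elimination is proved in the style of Cohen and Hoermander. For a finite family of
  polynomials in one variable whose coefficients depend on parameters, the table of all signs
  along the real line is determined by signs of finitely many functions of the parameters
  (\<open>tabulated_piecewise_poly\<close>). A polynomial \<open>q\<close> of highest degree is
  added as follows: at a root of another member \<open>j\<close>, the sign of \<open>q\<close> is
  the sign of a polynomial of smaller degree obtained by a step of pseudo-division by
  \<open>j\<close>, and between roots of its derivative \<open>q\<close> is monotone, so the signs
  at the end points of such an interval show whether \<open>q\<close> has a root inside.
\<close>

section \<open>Sign tables of finite families of real polynomials\<close>

text \<open>
  Families of real polynomials are indexed by an arbitrary type, and a sign vector is a function
  on that type which vanishes off the family. Thus adding a polynomial is a function update,
  passing to a subfamily is \<open>restrict_to\<close>, and no positions in lists have to be
  tracked.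
\<close>
definition signs :: "'i set \<Rightarrow> ('i \<Rightarrow> real poly) \<Rightarrow> real \<Rightarrow> 'i \<Rightarrow> real" where
  "signs I p x = (\<lambda>i. if i \<in> I then sgn (poly (p i) x) else 0)"

definition restrict_to :: "'i set \<Rightarrow> ('i \<Rightarrow> real) \<Rightarrow> 'i \<Rightarrow> real" where
  "restrict_to J w = (\<lambda>i. if i \<in> J then w i else 0)"

text \<open>
  A decomposition of the half-line to the right of \<open>a\<close> into open intervals and
  separating points: \<open>v\<close> is the constant value of \<open>\<psi>\<close> on the
  leftmost interval, and each pair of the list records the value of \<open>\<phi>\<close> at the
  next separating point and that of \<open>\<psi>\<close> on the interval behind it. Two different
  labellings are allowed because, while a polynomial is being added to a family, its signs are
  known at the points before they are known on the intervals. The points themselves are not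
  stored: a table is a finite combinatorial object, which is what makes it possible for it to
  depend only on signs of coefficient expressions.
\<close>
fun table :: "(real \<Rightarrow> 'a) \<Rightarrow> (real \<Rightarrow> 'b) \<Rightarrow> ereal \<Rightarrow> 'b \<Rightarrow> ('a \<times> 'b) list \<Rightarrow> bool" where
  "table \<phi> \<psi> a v [] \<longleftrightarrow> (\<forall>x. a < ereal x \<longrightarrow> \<psi> x = v)"
| "table \<phi> \<psi> a v ((w, v') # T) \<longleftrightarrow>
    (\<exists>b. a < ereal b \<and> (\<forall>x. a < ereal x \<and> x < b \<longrightarrow> \<psi> x = v) \<and> \<phi> b = w \<and> table \<phi> \<psi> (ereal b) v' T)"

lemma table_map:
  assumes "table \<phi> \<psi> a v T" "\<And>x. \<phi>' x = f (\<phi> x)" "\<And>x. \<psi>' x = g (\<psi> x)"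
  shows "table \<phi>' \<psi>' a (g v) (map (map_prod f g) T)"
  using assms(1)
proof (induction T arbitrary: a v)
  case Nil
  then show ?case by (auto simp: assms)
next
  case (Cons c T)
  then show ?case by (cases c) (auto simp: assms(2,3))
qed

lemma ereal_less_mono:
  "a < ereal x \<Longrightarrow> x \<le> y \<Longrightarrow> a < ereal y"
  "ereal y < b \<Longrightarrow> x \<le> y \<Longrightarrow> ereal x < b"
  by (meson ereal_less_eq(3) order_less_le_trans order_le_less_trans)+

lemma ereal_interval_nonempty:
  fixes a b :: ereal
  assumes "a < b"
  obtains x where "a < ereal x" "ereal x < b"
  using ereal_dense2[OF assms] by blast

lemma table_first_cell:
  assumes "table \<phi> \<psi> a v T" "a < \<infinity>"
  obtains b where "a < b" "\<And>x. a < ereal x \<Longrightarrow> ereal x < b \<Longrightarrow> \<psi> x = v"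
proof (cases T)
  case Nil
  then show ?thesis using assms that[of \<infinity>] by auto
next
  case (Cons c T')
  obtain w v' where "c = (w, v')" by (cases c)
  then obtain b where "a < ereal b" "\<forall>x. a < ereal x \<and> x < b \<longrightarrow> \<psi> x = v"
    using assms Cons by auto
  then show ?thesis using that[of "ereal b"] by auto
qed

lemma table_realized:
  assumes "table \<phi> \<phi> a v T" "a < \<infinity>"
  shows "(\<exists>x. a < ereal x \<and> Q (\<phi> x)) \<longleftrightarrow> Q v \<or> (\<exists>(w, u)\<in>set T. Q w \<or> Q u)"
  using assms
proof (induction T arbitrary: a v)
  case Nil
  then obtain x where "a < ereal x" using ereal_interval_nonempty by blast
  with Nil show ?case by auto
next
  case (Cons c T)
  obtain w v' where c: "c = (w, v')" by (cases c)
  then obtain b where b: "a < ereal b" "\<forall>x. a < ereal x \<and> x < b \<longrightarrow> \<phi> x = v" "\<phi> b = w"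
    "table \<phi> \<phi> (ereal b) v' T"
    using Cons.prems by auto
  obtain x0 where x0: "a < ereal x0" "x0 < b"
    using ereal_interval_nonempty[OF b(1)] by auto
  have IH: "(\<exists>x. ereal b < ereal x \<and> Q (\<phi> x)) \<longleftrightarrow> Q v' \<or> (\<exists>(w, u)\<in>set T. Q w \<or> Q u)"
    using Cons.IH[OF b(4)] by simp
  have "(\<exists>x. a < ereal x \<and> Q (\<phi> x)) \<longleftrightarrow>
      (\<exists>x. a < ereal x \<and> x < b \<and> Q (\<phi> x)) \<or> Q (\<phi> b) \<or> (\<exists>x. ereal b < ereal x \<and> Q (\<phi> x))"
    using b(1) by (metis ereal_less_eq(3) less_ereal.simps(1) linorder_less_linear order_less_trans)
  also have "(\<exists>x. a < ereal x \<and> x < b \<and> Q (\<phi> x)) \<longleftrightarrow> Q v"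
    using b x0 by metis
  finally show ?case using IH b(3) by (auto simp: c)
qed

text \<open>
  This is what happens when the separating point \<open>b\<close> is deleted because nothing
  changes there.
\<close>
lemma table_extend_left:
  assumes "table \<phi> \<psi> (ereal b) v T" "a < ereal b" "\<And>x. a < ereal x \<Longrightarrow> x \<le> b \<Longrightarrow> \<psi> x = v"
  shows "table \<phi> \<psi> a v T"
proof (cases T)
  case Nil
  then show ?thesis using assms by (auto) (metis not_less)
next
  case (Cons c T')
  obtain w v' where c: "c = (w, v')" by (cases c)
  then obtain d where d: "b < d" "\<forall>x. b < x \<and> x < d \<longrightarrow> \<psi> x = v" "\<phi> d = w"
    "table \<phi> \<psi> (ereal d) v' T'"
    using assms(1) Cons by auto
  have "a < ereal d" using assms(2) d(1) by (metis less_ereal.simps(1) order_less_trans)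
  moreover have "\<forall>x. a < ereal x \<and> x < d \<longrightarrow> \<psi> x = v" using assms(3) d(2) by (metis not_less)
  ultimately show ?thesis using d Cons c by auto
qed

lemma sgn_poly_near:
  fixes q :: "real poly"
  assumes "poly q b \<noteq> 0"
  obtains \<delta> where "\<delta> > 0" "\<And>x. \<bar>x - b\<bar> < \<delta> \<Longrightarrow> sgn (poly q x) = sgn (poly q b)"
proof -
  have "isCont (poly q) b" by simp
  then obtain \<delta> where \<delta>: "\<delta> > 0" "\<And>x. dist x b < \<delta> \<Longrightarrow> dist (poly q x) (poly q b) < \<bar>poly q b\<bar>"
    using assms unfolding continuous_at_eps_delta by (metis zero_less_abs_iff)
  show ?thesis
  proof (rule that[OF \<delta>(1)])
    fix x assume "\<bar>x - b\<bar> < \<delta>"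
    with \<delta>(2)[of x] show "sgn (poly q x) = sgn (poly q b)"
      by (auto simp: dist_real_def sgn_if abs_if split: if_splits)
  qed
qed

lemma poly_zero_on_interval:
  fixes q :: "real poly" and a b :: ereal
  assumes "a < b" "\<And>x. a < ereal x \<Longrightarrow> ereal x < b \<Longrightarrow> poly q x = 0"
  shows "q = 0"
proof (rule ccontr)
  assume "q \<noteq> 0"
  then have fin: "finite {x. poly q x = 0}" by (rule poly_roots_finite)
  obtain c where c: "a < ereal c" "ereal c < b" by (rule ereal_interval_nonempty[OF assms(1)])
  obtain d where d: "ereal c < ereal d" "ereal d < b" by (rule ereal_interval_nonempty[OF c(2)])
  have "{c<..<d} \<subseteq> {x. poly q x = 0}"
    using assms(2) ereal_less_mono(1)[OF c(1)] ereal_less_mono(2)[OF d(2)] by auto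
  with fin have "finite {c<..<d}" by (rule finite_subset[rotated])
  with d(1) show False by (simp add: infinite_Ioo)
qed

text \<open>
  Column \<open>(w, v)\<close> of a table belongs to a root of \<open>j\<close> where
  \<open>j\<close> is not the zero polynomial: a polynomial that vanishes at the point but not on
  the adjacent interval.
\<close>
definition root_column :: "'i set \<Rightarrow> ('i \<Rightarrow> real) \<Rightarrow> ('i \<Rightarrow> real) \<Rightarrow> 'i \<Rightarrow> bool" where
  "root_column J w v j \<longleftrightarrow> j \<in> J \<and> w j = 0 \<and> v j \<noteq> 0"

text \<open>
  The sign of the new polynomial \<open>q\<close> at a root of \<open>j\<close> is read off from
  the polynomial \<open>r j\<close>, which agrees in sign with \<open>q\<close> at all roots of
  \<open>j\<close>. Any root column serves, hence the choice.
\<close>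
definition point_signs :: "'i \<Rightarrow> 'i set \<Rightarrow> ('i \<Rightarrow> 'i) \<Rightarrow> ('i \<Rightarrow> real) \<Rightarrow> ('i \<Rightarrow> real) \<Rightarrow> 'i \<Rightarrow> real" where
  "point_signs q J r w v = (restrict_to J w)(q := w (r (SOME j. root_column J w v j)))"

definition coarsen :: "'i \<Rightarrow> 'i set \<Rightarrow> ('i \<Rightarrow> 'i) \<Rightarrow> (('i \<Rightarrow> real) \<times> ('i \<Rightarrow> real)) list
    \<Rightarrow> (('i \<Rightarrow> real) \<times> ('i \<Rightarrow> real)) list" where
  "coarsen q J r T = map (\<lambda>(w, v). (point_signs q J r w v, restrict_to J v))
     (filter (\<lambda>(w, v). \<exists>j. root_column J w v j) T)"

lemma signs_restrict: "J \<subseteq> I \<Longrightarrow> signs J p x = restrict_to J (signs I p x)"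
  by (rule ext) (auto simp: signs_def restrict_to_def)

lemma signs_insert: "signs (insert q J) p x = (signs J p x)(q := sgn (poly (p q) x))"
  by (auto simp: signs_def)

text \<open>
  Polynomials outside \<open>J\<close> are forgotten together with the points that are roots of
  those polynomials only, while the sign of \<open>q\<close> is gained at the remaining points. A
  point at which every \<open>j \<in> J\<close> with value zero is also zero on the following
  interval can be deleted, since then no member of \<open>J\<close> changes sign there: a
  polynomial that is zero on an interval is zero, and any other one is nonzero at the point and
  keeps its sign nearby.
\<close>
lemma table_coarsen:
  assumes "table (signs I p) (signs I p) a v T" "a < \<infinity>" "J \<subseteq> I"
    and r: "\<And>j b. j \<in> J \<Longrightarrow> p j \<noteq> 0 \<Longrightarrow> poly (p j) b = 0 \<Longrightarrow>
      r j \<in> I \<and> sgn (poly (p q) b) = sgn (poly (p (r j)) b)"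
  shows "table (signs (insert q J) p) (signs J p) a (restrict_to J v) (coarsen q J r T)"
  using assms(1,2)
proof (induction T arbitrary: a v)
  case Nil
  then show ?case using \<open>J \<subseteq> I\<close> by (auto simp: coarsen_def signs_restrict)
next
  case (Cons c T)
  obtain w v' where c: "c = (w, v')" by (cases c)
  then obtain b where b: "a < ereal b" "\<forall>x. a < ereal x \<and> x < b \<longrightarrow> signs I p x = v"
    "signs I p b = w" "table (signs I p) (signs I p) (ereal b) v' T"
    using Cons.prems by auto
  have IH: "table (signs (insert q J) p) (signs J p) b (restrict_to J v') (coarsen q J r T)"
    using Cons.IH[OF b(4)] by simp
  obtain d where d: "ereal b < d" "\<And>x. ereal b < ereal x \<Longrightarrow> ereal x < d \<Longrightarrow> signs I p x = v'"
    using table_first_cell[OF b(4)] by auto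
  show ?case
  proof (cases "\<exists>j. root_column J w v' j")
    case True
    define j where "j = (SOME j. root_column J w v' j)"
    have "root_column J w v' j" unfolding j_def using True by (rule someI_ex)
    then have j: "j \<in> J" "w j = 0" "v' j \<noteq> 0" by (auto simp: root_column_def)
    have "poly (p j) b = 0" using j b(3) \<open>J \<subseteq> I\<close> by (auto simp: signs_def sgn_zero_iff)
    moreover have "p j \<noteq> 0"
    proof
      assume "p j = 0"
      obtain x where "ereal b < ereal x" "ereal x < d" using ereal_interval_nonempty[OF d(1)] .
      from d(2)[OF this] \<open>p j = 0\<close> have "v' j = 0" by (auto simp: signs_def)
      with j show False by simp
    qed
    ultimately have "r j \<in> I \<and> sgn (poly (p q) b) = sgn (poly (p (r j)) b)"
      using r j by blast
    then have "sgn (poly (p q) b) = w (r j)" using b(3) by (auto simp: signs_def)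
    then have "signs (insert q J) p b = point_signs q J r w v'"
      using b(3) \<open>J \<subseteq> I\<close> by (simp add: signs_insert point_signs_def signs_restrict j_def)
    moreover have "\<forall>x. a < ereal x \<and> x < b \<longrightarrow> signs J p x = restrict_to J v"
      using b(2) \<open>J \<subseteq> I\<close> by (auto simp: signs_restrict)
    ultimately have "table (signs (insert q J) p) (signs J p) a (restrict_to J v)
        ((point_signs q J r w v', restrict_to J v') # coarsen q J r T)"
      using IH b(1) by auto
    then show ?thesis using True by (simp add: c coarsen_def)
  next
    case False
    have eq: "w j = v' j \<and> v j = v' j" if "j \<in> J" for j
    proof (cases "poly (p j) b = 0")
      case True
      then have "w j = 0" using b(3) by (auto simp: signs_def)
      then have v'0: "v' j = 0" using False that by (auto simp: root_column_def)
      have "p j = 0"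
      proof (rule poly_zero_on_interval[OF d(1)])
        fix x assume "ereal b < ereal x" "ereal x < d"
        from d(2)[OF this] v'0 that \<open>J \<subseteq> I\<close> show "poly (p j) x = 0"
          by (auto simp: signs_def sgn_zero_iff dest!: fun_cong[where x = j])
      qed
      obtain x where "a < ereal x" "ereal x < b" using ereal_interval_nonempty[OF b(1)] .
      then have "v j = 0" using b(2) \<open>p j = 0\<close> by (auto simp: signs_def)
      with v'0 \<open>w j = 0\<close> show ?thesis by simp
    next
      case False
      then obtain \<delta> where \<delta>: "\<delta> > 0" "\<And>x. \<bar>x - b\<bar> < \<delta> \<Longrightarrow> sgn (poly (p j) x) = sgn (poly (p j) b)"
        by (rule sgn_poly_near) blast
      have "max a (ereal (b - \<delta>)) < ereal b" using b(1) \<delta>(1) by simp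
      then obtain x where x: "a < ereal x" "b - \<delta> < x" "x < b"
        using ereal_interval_nonempty[of "max a (ereal (b - \<delta>))" "ereal b"] by auto
      have "ereal b < min d (ereal (b + \<delta>))" using d(1) \<delta>(1) by simp
      then obtain y where y: "b < y" "ereal y < d" "y < b + \<delta>"
        using ereal_interval_nonempty[of "ereal b" "min d (ereal (b + \<delta>))"] by auto
      have "signs I p x j = signs I p b j" "signs I p y j = signs I p b j"
        using \<delta>(2)[of x] \<delta>(2)[of y] x y by (auto simp: signs_def)
      moreover have "signs I p x = v" "signs I p y = v'" using b(2) d(2)[of y] x y by auto
      ultimately show ?thesis using b(3) by simp
    qed
    then have "restrict_to J w = restrict_to J v'" "restrict_to J v = restrict_to J v'"
      by (auto simp: restrict_to_def)
    moreover have "table (signs (insert q J) p) (signs J p) a (restrict_to J v') (coarsen q J r T)"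
    proof (rule table_extend_left[OF IH b(1)])
      fix x assume "a < ereal x" "x \<le> b"
      then have "signs I p x = v \<or> signs I p x = w" using b(2,3) by (cases "x = b") auto
      then show "signs J p x = restrict_to J v'" using calculation \<open>J \<subseteq> I\<close> by (auto simp: signs_restrict)
    qed
    moreover have "coarsen q J r (c # T) = coarsen q J r T" using False by (simp add: c coarsen_def)
    ultimately show ?thesis by simp
  qed
qed

lemma poly_strict_mono_on_interval:
  fixes q :: "real poly" and a b :: ereal
  assumes "\<And>x. a < ereal x \<Longrightarrow> ereal x < b \<Longrightarrow> poly (pderiv q) x > 0"
    and "a \<le> ereal x" "x < y" "ereal y \<le> b"
  shows "poly q x < poly q y"
proof -
  obtain z where z: "x < z" "z < y" "poly q y - poly q x = (y - x) * poly (pderiv q) z"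
    using poly_MVT[OF \<open>x < y\<close>] by blast
  have "a < ereal z" "ereal z < b"
    using assms(2,4) z by (metis less_ereal.simps(1) order_le_less_trans order_less_le_trans)+
  then have "poly (pderiv q) z > 0" using assms(1) by blast
  then have "(y - x) * poly (pderiv q) z > 0" using \<open>x < y\<close> by simp
  then show ?thesis using z(3) by linarith
qed

section \<open>Inserting the roots of a polynomial between the roots of its derivative\<close>

text \<open>
  A strictly increasing polynomial is determined on an interval, as far as signs are concerned, by
  its signs near both ends: equal signs leave no room for a root, different signs force exactly
  one root by the intermediate value theorem.
\<close>
lemma increasing_cell:
  fixes q :: "real poly" and a b :: ereal
  assumes "a < b"
    and pos: "\<And>x. a < ereal x \<Longrightarrow> ereal x < b \<Longrightarrow> poly (pderiv q) x > 0"
    and left: "a < c" "\<And>x. a < ereal x \<Longrightarrow> ereal x < c \<Longrightarrow> sgn (poly q x) = \<sigma>"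
    and right: "c' < b" "\<And>x. c' < ereal x \<Longrightarrow> ereal x < b \<Longrightarrow> sgn (poly q x) = \<rho>"
    and nz: "\<sigma> \<noteq> 0" "\<rho> \<noteq> 0"
  shows "\<sigma> = \<rho> \<Longrightarrow> \<forall>x. a < ereal x \<and> ereal x < b \<longrightarrow> sgn (poly q x) = \<sigma>"
    and "\<sigma> \<noteq> \<rho> \<Longrightarrow> \<exists>z. a < ereal z \<and> ereal z < b \<and> poly q z = 0 \<and>
      (\<forall>x. a < ereal x \<and> x < z \<longrightarrow> sgn (poly q x) = \<sigma>) \<and>
      (\<forall>x. z < x \<and> ereal x < b \<longrightarrow> sgn (poly q x) = \<rho>)"
proof -
  have mono: "poly q x < poly q y" if "a < ereal x" "x < y" "ereal y < b" for x y
    using poly_strict_mono_on_interval[of a b q x y] pos that by simp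
  have ends: "\<exists>x0 x1. a < ereal x0 \<and> x0 < m \<and> m < x1 \<and> ereal x1 < b \<and>
      sgn (poly q x0) = \<sigma> \<and> sgn (poly q x1) = \<rho>" if "a < ereal m" "ereal m < b" for m
  proof -
    obtain x0 where x0: "a < ereal x0" "ereal x0 < min c (ereal m)"
      using ereal_interval_nonempty[of a "min c (ereal m)"] left(1) \<open>a < ereal m\<close> by auto
    obtain x1 where x1: "max c' (ereal m) < ereal x1" "ereal x1 < b"
      using ereal_interval_nonempty[of "max c' (ereal m)" b] right(1) \<open>ereal m < b\<close> by auto
    show ?thesis using x0 x1 left(2)[of x0] right(2)[of x1] by auto
  qed
  show "\<forall>x. a < ereal x \<and> ereal x < b \<longrightarrow> sgn (poly q x) = \<sigma>" if "\<sigma> = \<rho>"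
  proof (intro allI impI)
    fix x assume x: "a < ereal x \<and> ereal x < b"
    then obtain x0 x1 where *: "a < ereal x0" "x0 < x" "x < x1" "ereal x1 < b"
      "sgn (poly q x0) = \<sigma>" "sgn (poly q x1) = \<rho>" using ends[of x] by blast
    have "poly q x0 < poly q x" "poly q x < poly q x1" using mono * x by auto
    with * nz that show "sgn (poly q x) = \<sigma>" by (auto simp: sgn_if split: if_splits)
  qed
  assume "\<sigma> \<noteq> \<rho>"
  obtain m where "a < ereal m" "ereal m < b" using ereal_interval_nonempty[OF \<open>a < b\<close>] .
  from ends[OF this] obtain x0 x1 where *: "a < ereal x0" "x0 < m" "m < x1" "ereal x1 < b"
    "sgn (poly q x0) = \<sigma>" "sgn (poly q x1) = \<rho>" by blast
  have "x0 < x1" using *(2,3) by (rule order_less_trans)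
  have "poly q x0 < poly q x1" by (rule mono[OF *(1) \<open>x0 < x1\<close> *(4)])
  then have sg: "poly q x0 < 0" "poly q x1 > 0" "\<sigma> = -1" "\<rho> = 1"
    using *(5,6) \<open>\<sigma> \<noteq> \<rho>\<close> nz by (auto simp: sgn_if split: if_splits)
  then obtain z where z: "x0 < z" "z < x1" "poly q z = 0" using poly_IVT_pos[OF \<open>x0 < x1\<close>] by blast
  have az: "a < ereal z" "ereal z < b"
    using ereal_less_mono(1)[OF *(1), of z] ereal_less_mono(2)[OF *(4), of z] z by auto
  have "sgn (poly q x) = \<sigma>" if "a < ereal x" "x < z" for x
    using mono[OF that az(2)] z(3) sg by simp
  moreover have "sgn (poly q x) = \<rho>" if "z < x" "ereal x < b" for x
    using mono[OF az(1) that] z(3) sg by simp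
  ultimately show "\<exists>z. a < ereal z \<and> ereal z < b \<and> poly q z = 0 \<and>
      (\<forall>x. a < ereal x \<and> x < z \<longrightarrow> sgn (poly q x) = \<sigma>) \<and>
      (\<forall>x. z < x \<and> ereal x < b \<longrightarrow> sgn (poly q x) = \<rho>)"
    using az z(3) by blast
qed

lemma sgn_poly_smult_unit:
  fixes q :: "real poly"
  assumes "\<tau> = 1 \<or> \<tau> = -1"
  shows "sgn (poly (smult \<tau> q) x) = \<tau> * sgn (poly q x)"
  using assms by (auto simp: sgn_minus)

text \<open>
  The same for a derivative of either constant sign \<open>\<tau>\<close>, by passing to
  \<open>\<tau> q\<close>.
\<close>
lemma monotone_cell:
  fixes q :: "real poly" and a b :: ereal
  assumes "a < b"
    and deriv: "\<And>x. a < ereal x \<Longrightarrow> ereal x < b \<Longrightarrow> sgn (poly (pderiv q) x) = \<tau>" and "\<tau> \<noteq> 0"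
    and left: "a < c" "\<And>x. a < ereal x \<Longrightarrow> ereal x < c \<Longrightarrow> sgn (poly q x) = \<sigma>"
    and right: "c' < b" "\<And>x. c' < ereal x \<Longrightarrow> ereal x < b \<Longrightarrow> sgn (poly q x) = \<rho>"
    and nz: "\<sigma> \<noteq> 0" "\<rho> \<noteq> 0"
  shows "\<sigma> = \<rho> \<Longrightarrow> \<forall>x. a < ereal x \<and> ereal x < b \<longrightarrow> sgn (poly q x) = \<sigma>"
    and "\<sigma> \<noteq> \<rho> \<Longrightarrow> \<exists>z. a < ereal z \<and> ereal z < b \<and> poly q z = 0 \<and>
      (\<forall>x. a < ereal x \<and> x < z \<longrightarrow> sgn (poly q x) = \<sigma>) \<and>
      (\<forall>x. z < x \<and> ereal x < b \<longrightarrow> sgn (poly q x) = \<rho>)"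
proof -
  obtain m where "a < ereal m" "ereal m < b" using ereal_interval_nonempty[OF \<open>a < b\<close>] .
  from deriv[OF this] \<open>\<tau> \<noteq> 0\<close> have \<tau>: "\<tau> = 1 \<or> \<tau> = -1" by (auto simp: sgn_if split: if_splits)
  then have \<tau>\<tau>: "\<tau> * \<tau> = 1" by auto
  then have cancel: "\<tau> * u = \<tau> * v \<longleftrightarrow> u = v" for u v :: real using \<open>\<tau> \<noteq> 0\<close> by simp
  have 1: "poly (pderiv (smult \<tau> q)) x > 0" if "a < ereal x" "ereal x < b" for x
    using deriv[OF that] \<tau> by (auto simp: pderiv_smult sgn_if split: if_splits)
  have 2: "sgn (poly (smult \<tau> q) x) = \<tau> * \<sigma>" if "a < ereal x" "ereal x < c" for x
    using left(2)[OF that] by (simp only: sgn_poly_smult_unit[OF \<tau>])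
  have 3: "sgn (poly (smult \<tau> q) x) = \<tau> * \<rho>" if "c' < ereal x" "ereal x < b" for x
    using right(2)[OF that] by (simp only: sgn_poly_smult_unit[OF \<tau>])
  have 4: "\<tau> * \<sigma> \<noteq> 0" "\<tau> * \<rho> \<noteq> 0" using nz \<open>\<tau> \<noteq> 0\<close> by auto
  note unit = sgn_poly_smult_unit[OF \<tau>]
  show "\<forall>x. a < ereal x \<and> ereal x < b \<longrightarrow> sgn (poly q x) = \<sigma>" if "\<sigma> = \<rho>"
  proof -
    have "\<forall>x. a < ereal x \<and> ereal x < b \<longrightarrow> sgn (poly (smult \<tau> q) x) = \<tau> * \<sigma>"
      by (rule increasing_cell(1)[OF \<open>a < b\<close> _ left(1) _ right(1) _ 4]) (use 1 2 3 that in blast)+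
    then show ?thesis unfolding unit cancel .
  qed
  show "\<exists>z. a < ereal z \<and> ereal z < b \<and> poly q z = 0 \<and>
      (\<forall>x. a < ereal x \<and> x < z \<longrightarrow> sgn (poly q x) = \<sigma>) \<and>
      (\<forall>x. z < x \<and> ereal x < b \<longrightarrow> sgn (poly q x) = \<rho>)" if "\<sigma> \<noteq> \<rho>"
  proof -
    have ne: "\<tau> * \<sigma> \<noteq> \<tau> * \<rho>" unfolding cancel by (rule that)
    have "\<exists>z. a < ereal z \<and> ereal z < b \<and> poly (smult \<tau> q) z = 0 \<and>
      (\<forall>x. a < ereal x \<and> x < z \<longrightarrow> sgn (poly (smult \<tau> q) x) = \<tau> * \<sigma>) \<and>
      (\<forall>x. z < x \<and> ereal x < b \<longrightarrow> sgn (poly (smult \<tau> q) x) = \<tau> * \<rho>)"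
      by (rule increasing_cell(2)[OF \<open>a < b\<close> _ left(1) _ right(1) _ 4 ne]) (use 1 2 3 in blast)+
    moreover have "poly (smult \<tau> q) z = 0 \<longleftrightarrow> poly q z = 0" for z using \<open>\<tau> \<noteq> 0\<close> by simp
    ultimately show ?thesis unfolding unit cancel by blast
  qed
qed

text \<open>
  At a root the sign just to the right is the one of the derivative, by the mean value theorem.
\<close>
lemma sgn_poly_right_of:
  fixes q :: "real poly"
  assumes "ereal \<alpha> < b" "\<And>x. \<alpha> < x \<Longrightarrow> ereal x < b \<Longrightarrow> sgn (poly (pderiv q) x) = \<tau>"
  shows "\<exists>c>ereal \<alpha>. \<forall>x. \<alpha> < x \<and> ereal x < c \<longrightarrow>
    sgn (poly q x) = (if poly q \<alpha> = 0 then \<tau> else sgn (poly q \<alpha>))"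
proof (cases "poly q \<alpha> = 0")
  case True
  have "sgn (poly q x) = \<tau>" if x: "\<alpha> < x" "ereal x < b" for x
  proof -
    obtain z where z: "\<alpha> < z" "z < x" "poly q x - poly q \<alpha> = (x - \<alpha>) * poly (pderiv q) z"
      using poly_MVT[OF x(1)] by blast
    have "sgn (poly (pderiv q) z) = \<tau>" using assms(2)[of z] z ereal_less_mono(2)[OF x(2), of z] by simp
    then show ?thesis using z(3) True x(1) by (simp add: sgn_mult)
  qed
  then show ?thesis using True assms(1) by (intro exI[of _ b] conjI) simp_all
next
  case False
  then obtain \<delta> where \<delta>: "\<delta> > 0" "\<And>x. \<bar>x - \<alpha>\<bar> < \<delta> \<Longrightarrow> sgn (poly q x) = sgn (poly q \<alpha>)"
    by (rule sgn_poly_near) blast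
  have "sgn (poly q x) = sgn (poly q \<alpha>)" if "\<alpha> < x \<and> x < \<alpha> + \<delta>" for x
    by (rule \<delta>(2)) (use that in linarith)
  then show ?thesis using False \<delta>(1) by (intro exI[of _ "ereal (\<alpha> + \<delta>)"] conjI) simp_all
qed

lemma sgn_poly_left_of:
  fixes q :: "real poly"
  assumes "a < ereal \<beta>" "\<And>x. a < ereal x \<Longrightarrow> x < \<beta> \<Longrightarrow> sgn (poly (pderiv q) x) = \<tau>"
  shows "\<exists>c<ereal \<beta>. \<forall>x. c < ereal x \<and> x < \<beta> \<longrightarrow>
    sgn (poly q x) = (if poly q \<beta> = 0 then - \<tau> else sgn (poly q \<beta>))"
proof (cases "poly q \<beta> = 0")
  case True
  have "sgn (poly q x) = - \<tau>" if x: "a < ereal x" "x < \<beta>" for x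
  proof -
    obtain z where z: "x < z" "z < \<beta>" "poly q \<beta> - poly q x = (\<beta> - x) * poly (pderiv q) z"
      using poly_MVT[OF x(2)] by blast
    have "sgn (poly (pderiv q) z) = \<tau>" using assms(2)[of z] z ereal_less_mono(1)[OF x(1), of z] by simp
    moreover have "poly q x = - ((\<beta> - x) * poly (pderiv q) z)" using z(3) True by simp
    ultimately show ?thesis using x(2) by (simp add: sgn_mult sgn_minus)
  qed
  then show ?thesis using True assms(1) by (intro exI[of _ a] conjI) simp_all
next
  case False
  then obtain \<delta> where \<delta>: "\<delta> > 0" "\<And>x. \<bar>x - \<beta>\<bar> < \<delta> \<Longrightarrow> sgn (poly q x) = sgn (poly q \<beta>)"
    by (rule sgn_poly_near) blast
  have "sgn (poly q x) = sgn (poly q \<beta>)" if "\<beta> - \<delta> < x \<and> x < \<beta>" for x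
    by (rule \<delta>(2)) (use that in linarith)
  then show ?thesis using False \<delta>(1) by (intro exI[of _ "ereal (\<beta> - \<delta>)"] conjI) simp_all
qed

lemma sgn_poly_at_top:
  fixes q :: "real poly"
  assumes "q \<noteq> 0"
  shows "\<exists>n. \<forall>x\<ge>n. sgn (poly q x) = sgn (lead_coeff q)"
proof (cases "lead_coeff q > 0")
  case True
  from poly_pinfty_gt_lc[OF this] obtain n where n: "\<And>x. x \<ge> n \<Longrightarrow> poly q x \<ge> lead_coeff q" by blast
  have "sgn (poly q x) = sgn (lead_coeff q)" if "x \<ge> n" for x using n[OF that] True by simp
  then show ?thesis by blast
next
  case False
  then have neg: "lead_coeff (- q) > 0" using assms by (simp add: less_le)
  from poly_pinfty_gt_lc[OF neg] obtain n where n: "\<And>x. x \<ge> n \<Longrightarrow> poly (- q) x \<ge> lead_coeff (- q)"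
    by blast
  have "sgn (poly q x) = sgn (lead_coeff q)" if "x \<ge> n" for x
  proof -
    have "poly q x < 0" using n[OF that] neg by (simp only: poly_minus)
    with neg show ?thesis by simp
  qed
  then show ?thesis by blast
qed

text \<open>
  A nonconstant polynomial and its derivative have leading coefficients of the same sign.
\<close>
lemma sgn_poly_near_infinity:
  fixes q :: "real poly"
  assumes "degree q > 0" "\<And>x. a < x \<Longrightarrow> sgn (poly (pderiv q) x) = \<tau>"
  shows "\<exists>c. \<forall>x>c. sgn (poly q x) = \<tau>"
proof -
  have "q \<noteq> 0" "pderiv q \<noteq> 0" using assms(1) by (auto simp: pderiv_eq_0_iff)
  then obtain m n where mn: "\<forall>x\<ge>m. sgn (poly q x) = sgn (lead_coeff q)"
    "\<forall>x\<ge>n. sgn (poly (pderiv q) x) = sgn (lead_coeff (pderiv q))"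
    using sgn_poly_at_top by metis
  have "lead_coeff (pderiv q) = of_nat (degree q) * lead_coeff q"
    using assms(1) by (simp add: degree_pderiv coeff_pderiv)
  then have "sgn (lead_coeff (pderiv q)) = sgn (lead_coeff q)" using assms(1) by (simp add: sgn_mult)
  moreover have "sgn (lead_coeff (pderiv q)) = \<tau>"
    using mn(2)[rule_format, of "max n (a + 1)"] assms(2)[of "max n (a + 1)"] by simp
  ultimately show ?thesis using mn(1) by (metis less_imp_le)
qed

lemma sgn_poly_near_minus_infinity:
  fixes q :: "real poly"
  assumes "degree q > 0" "\<And>x. x < b \<Longrightarrow> sgn (poly (pderiv q) x) = \<tau>"
  shows "\<exists>c. \<forall>x<c. sgn (poly q x) = - \<tau>"
proof -
  let ?q = "pcompose q [:0, -1:]"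
  have "sgn (poly (pderiv ?q) x) = - \<tau>" if "- b < x" for x
    using assms(2)[of "- x"] that by (simp add: pderiv_pcompose poly_pcompose sgn_minus pderiv_pCons)
  moreover have "degree ?q > 0" using assms(1) by (simp add: degree_pcompose)
  ultimately obtain c where c: "\<forall>x>c. sgn (poly ?q x) = - \<tau>"
    using sgn_poly_near_infinity[of ?q "- b" "- \<tau>"] by blast
  show ?thesis
  proof (intro exI allI impI)
    fix x assume "x < - c"
    then show "sgn (poly q x) = - \<tau>" using c[rule_format, of "- x"] by (simp add: poly_pcompose)
  qed
qed

text \<open>
  The part of a table from the right end \<open>b\<close> of its first interval on; it treats a
  bounded and an unbounded first interval alike.
\<close>
definition table_tail ::
  "(real \<Rightarrow> 'a) \<Rightarrow> (real \<Rightarrow> 'b) \<Rightarrow> ereal \<Rightarrow> ('a \<times> 'b) list \<Rightarrow> bool" where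
  "table_tail \<phi> \<psi> b R \<longleftrightarrow> (b = \<infinity> \<and> R = []) \<or>
    (\<exists>\<beta> u R'. b = ereal \<beta> \<and> R = (\<phi> \<beta>, u) # R' \<and> table \<phi> \<psi> (ereal \<beta>) u R')"

lemma tableI_tail:
  assumes "a < b" "\<And>x. a < ereal x \<Longrightarrow> ereal x < b \<Longrightarrow> \<psi> x = v" "table_tail \<phi> \<psi> b R"
  shows "table \<phi> \<psi> a v R"
  using assms unfolding table_tail_def by (elim disjE exE conjE) (simp_all, blast)

text \<open>
  An interval on which \<open>q\<close> is monotone with sign \<open>\<sigma>\<close> near the
  left end and \<open>\<rho>\<close> near the right end is cut at the root of \<open>q\<close>
  when the two signs differ.
\<close>
definition split_cell :: "'i \<Rightarrow> real \<Rightarrow> real \<Rightarrow> ('i \<Rightarrow> real) \<Rightarrow> (('i \<Rightarrow> real) \<times> ('i \<Rightarrow> real)) list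
    \<Rightarrow> ('i \<Rightarrow> real) \<times> (('i \<Rightarrow> real) \<times> ('i \<Rightarrow> real)) list" where
  "split_cell q \<sigma> \<rho> v R =
    (if \<sigma> = \<rho> then (v(q := \<sigma>), R) else (v(q := \<sigma>), (v(q := 0), v(q := \<rho>)) # R))"

text \<open>
  Here \<open>dq\<close> is the index of the derivative of \<open>q\<close>, and
  \<open>\<sigma>\<close> is the sign of \<open>q\<close> just to the right of the left end. If
  \<open>q\<close> vanishes at an end point of an interval, the derivative on
  that interval decides: \<open>q\<close> has the sign of the derivative to the right of its root
  and the opposite sign to the left. Near \<open>+\<infinity>\<close> the sign of \<open>q\<close>
  is that of its derivative.
\<close>
fun refine :: "'i \<Rightarrow> 'i \<Rightarrow> real \<Rightarrow> ('i \<Rightarrow> real) \<Rightarrow> (('i \<Rightarrow> real) \<times> ('i \<Rightarrow> real)) list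
    \<Rightarrow> ('i \<Rightarrow> real) \<times> (('i \<Rightarrow> real) \<times> ('i \<Rightarrow> real)) list" where
  "refine q dq \<sigma> v [] = split_cell q \<sigma> (v dq) v []"
| "refine q dq \<sigma> v ((w, v') # T) =
    split_cell q \<sigma> (if w q = 0 then - v dq else w q) v
      ((w, fst (refine q dq (if w q = 0 then v' dq else w q) v' T)) #
       snd (refine q dq (if w q = 0 then v' dq else w q) v' T))"

lemma table_split_cell:
  assumes "a < b" and cell: "\<And>x. a < ereal x \<Longrightarrow> ereal x < b \<Longrightarrow> signs J p x = v"
    and tail: "table_tail (signs (insert q J) p) (signs (insert q J) p) b R"
    and deriv: "dq \<in> J" "p dq = pderiv (p q)" "v dq \<noteq> 0"
    and left: "\<exists>c>a. \<forall>x. a < ereal x \<and> ereal x < c \<longrightarrow> sgn (poly (p q) x) = \<sigma>" "\<sigma> \<noteq> 0"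
    and right: "\<exists>c<b. \<forall>x. c < ereal x \<and> ereal x < b \<longrightarrow> sgn (poly (p q) x) = \<rho>" "\<rho> \<noteq> 0"
  shows "table (signs (insert q J) p) (signs (insert q J) p) a
    (fst (split_cell q \<sigma> \<rho> v R)) (snd (split_cell q \<sigma> \<rho> v R))"
proof -
  obtain c where c: "a < c" "\<And>x. a < ereal x \<Longrightarrow> ereal x < c \<Longrightarrow> sgn (poly (p q) x) = \<sigma>"
    using left(1) by blast
  obtain c' where c': "c' < b" "\<And>x. c' < ereal x \<Longrightarrow> ereal x < b \<Longrightarrow> sgn (poly (p q) x) = \<rho>"
    using right(1) by blast
  have d: "sgn (poly (pderiv (p q)) x) = v dq" if "a < ereal x" "ereal x < b" for x
    using fun_cong[OF cell[OF that], of dq] deriv(1,2) by (simp add: signs_def)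
  have upd: "signs (insert q J) p x = v(q := sgn (poly (p q) x))" if "a < ereal x" "ereal x < b" for x
    using cell[OF that] by (simp add: signs_insert)
  show ?thesis
  proof (cases "\<sigma> = \<rho>")
    case True
    have "\<forall>x. a < ereal x \<and> ereal x < b \<longrightarrow> sgn (poly (p q) x) = \<sigma>"
      by (rule monotone_cell(1)[OF \<open>a < b\<close> _ deriv(3) c(1) _ c'(1) _ left(2) right(2) True])
        (use d c(2) c'(2) in blast)+
    then have "table (signs (insert q J) p) (signs (insert q J) p) a (v(q := \<sigma>)) R"
      using upd by (intro tableI_tail[OF \<open>a < b\<close> _ tail]) simp
    then show ?thesis using True by (simp add: split_cell_def)
  next
    case False
    have "\<exists>z. a < ereal z \<and> ereal z < b \<and> poly (p q) z = 0 \<and>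
      (\<forall>x. a < ereal x \<and> x < z \<longrightarrow> sgn (poly (p q) x) = \<sigma>) \<and>
      (\<forall>x. z < x \<and> ereal x < b \<longrightarrow> sgn (poly (p q) x) = \<rho>)"
      by (rule monotone_cell(2)[OF \<open>a < b\<close> _ deriv(3) c(1) _ c'(1) _ left(2) right(2) False])
        (use d c(2) c'(2) in blast)+
    then obtain z where z: "a < ereal z" "ereal z < b" "poly (p q) z = 0"
      "\<And>x. a < ereal x \<Longrightarrow> x < z \<Longrightarrow> sgn (poly (p q) x) = \<sigma>"
      "\<And>x. z < x \<Longrightarrow> ereal x < b \<Longrightarrow> sgn (poly (p q) x) = \<rho>" by blast
    have 1: "table (signs (insert q J) p) (signs (insert q J) p) (ereal z) (v(q := \<rho>)) R"
    proof (rule tableI_tail[OF z(2) _ tail])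
      fix x assume "ereal z < ereal x" "ereal x < b"
      then show "signs (insert q J) p x = v(q := \<rho>)"
        using upd[of x] z(5)[of x] ereal_less_mono(1)[OF z(1), of x] by simp
    qed
    have 2: "signs (insert q J) p x = v(q := \<sigma>)" if "a < ereal x \<and> x < z" for x
      using upd[of x] z(4)[of x] ereal_less_mono(2)[OF z(2), of x] that by simp
    have 3: "signs (insert q J) p z = v(q := 0)" using upd[OF z(1,2)] z(3) by simp
    show ?thesis using False 1 2 3 z(1) by (auto simp: split_cell_def simp del: fun_upd_apply intro!: exI[of _ z])
  qed
qed

text \<open>
  Between consecutive roots of the derivative \<open>q\<close> is monotone, so knowing the sign of
  \<open>q\<close> at the points of the table suffices to insert all roots of \<open>q\<close>.
\<close>
lemma table_refine:
  assumes "table (signs (insert q J) p) (signs J p) a v T" "a < \<infinity>"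
    and deriv: "dq \<in> J" "p dq = pderiv (p q)" "degree (p q) > 0"
    and left: "\<exists>c>a. \<forall>x. a < ereal x \<and> ereal x < c \<longrightarrow> sgn (poly (p q) x) = \<sigma>" "\<sigma> \<noteq> 0"
  shows "table (signs (insert q J) p) (signs (insert q J) p) a
    (fst (refine q dq \<sigma> v T)) (snd (refine q dq \<sigma> v T))"
  using assms(1,2) left
proof (induction T arbitrary: a v \<sigma>)
  have nonzero: "u dq \<noteq> 0" if tab: "table \<phi> (signs J p) a u T" "a < \<infinity>" for \<phi> :: "real \<Rightarrow> 'i \<Rightarrow> real" and a u T
  proof
    assume "u dq = 0"
    obtain b where b: "a < b" "\<And>x. a < ereal x \<Longrightarrow> ereal x < b \<Longrightarrow> signs J p x = u"
      using table_first_cell[OF tab] by blast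
    have "pderiv (p q) = 0"
    proof (rule poly_zero_on_interval[OF b(1)])
      fix x assume "a < ereal x" "ereal x < b"
      from fun_cong[OF b(2)[OF this], of dq] \<open>u dq = 0\<close> deriv(1,2) show "poly (pderiv (p q)) x = 0"
        by (simp add: signs_def sgn_zero_iff)
    qed
    then show False using deriv(3) by (simp add: pderiv_eq_0_iff)
  qed
  {
    case (Nil a v \<sigma>)
    have v: "v dq \<noteq> 0" using nonzero[OF Nil.prems(1,2)] .
    obtain \<alpha> where \<alpha>: "a < ereal \<alpha>" using ereal_interval_nonempty[OF Nil.prems(2)] by blast
    have "sgn (poly (pderiv (p q)) x) = v dq" if "\<alpha> < x" for x
    proof -
      have "signs J p x = v" using Nil.prems(1) ereal_less_mono(1)[OF \<alpha>, of x] that by simp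
      from fun_cong[OF this, of dq] deriv(1,2) show ?thesis by (simp add: signs_def)
    qed
    from sgn_poly_near_infinity[OF deriv(3) this] obtain c where c: "\<forall>x>c. sgn (poly (p q) x) = v dq"
      by blast
    have "table (signs (insert q J) p) (signs (insert q J) p) a
        (fst (split_cell q \<sigma> (v dq) v [])) (snd (split_cell q \<sigma> (v dq) v []))"
    proof (rule table_split_cell[where b = "\<infinity>" and p = p and dq = dq])
      show "\<exists>c<\<infinity>. \<forall>x. c < ereal x \<and> ereal x < \<infinity> \<longrightarrow> sgn (poly (p q) x) = v dq"
        using c by (intro exI[of _ "ereal c"]) simp
    qed (use Nil.prems deriv v in \<open>auto simp: table_tail_def\<close>)
    then show ?case by simp
  next
    case (Cons cl T a v \<sigma>)
    obtain w v' where cl: "cl = (w, v')" by (cases cl)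
    from Cons.prems(1) obtain b where b: "a < ereal b" "\<forall>x. a < ereal x \<and> x < b \<longrightarrow> signs J p x = v"
      "signs (insert q J) p b = w" "table (signs (insert q J) p) (signs J p) (ereal b) v' T"
      unfolding cl table.simps by blast
    have v: "v dq \<noteq> 0" using nonzero[OF Cons.prems(1,2)] .
    have v': "v' dq \<noteq> 0" using nonzero[OF b(4)] by simp
    have wq: "w q = sgn (poly (p q) b)" using fun_cong[OF b(3), of q] by (simp add: signs_def)
    obtain d where d: "ereal b < d" "\<And>x. ereal b < ereal x \<Longrightarrow> ereal x < d \<Longrightarrow> signs J p x = v'"
      using table_first_cell[OF b(4)] by auto
    have "sgn (poly (pderiv (p q)) x) = v' dq" if "b < x" "ereal x < d" for x
      using fun_cong[OF d(2), of x dq] that deriv(1,2) by (simp add: signs_def)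
    from sgn_poly_right_of[OF d(1) this]
    have germ: "\<exists>c>ereal b. \<forall>x. ereal b < ereal x \<and> ereal x < c \<longrightarrow>
        sgn (poly (p q) x) = (if w q = 0 then v' dq else w q)"
      unfolding wq sgn_zero_iff less_ereal.simps .
    have germ_nz: "(if w q = 0 then v' dq else w q) \<noteq> 0" using v' by simp
    note IH = Cons.IH[OF b(4) _ germ germ_nz]
    have "sgn (poly (pderiv (p q)) x) = v dq" if "a < ereal x" "x < b" for x
      using fun_cong[OF b(2)[rule_format], of x dq] that deriv(1,2) by (simp add: signs_def)
    from sgn_poly_left_of[OF b(1) this]
    have germ': "\<exists>c<ereal b. \<forall>x. c < ereal x \<and> ereal x < ereal b \<longrightarrow>
        sgn (poly (p q) x) = (if w q = 0 then - v dq else w q)"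
      unfolding wq sgn_zero_iff less_ereal.simps .
    show ?case unfolding cl refine.simps
    proof (rule table_split_cell[where b = "ereal b" and p = p and dq = dq])
      show "table_tail (signs (insert q J) p) (signs (insert q J) p) (ereal b)
       ((w, fst (refine q dq (if w q = 0 then v' dq else w q) v' T)) #
        snd (refine q dq (if w q = 0 then v' dq else w q) v' T))"
        unfolding table_tail_def b(3)[symmetric] using IH[unfolded b(3)[symmetric]] by simp
    qed (use b germ' v deriv Cons.prems in auto)
  }
qed

section \<open>Functions determined by finitely many signs\<close>

text \<open>
  The parameters \<open>e\<close> range over an arbitrary type. Everything below is expressed
  through the dependence on the signs of finitely many functions of the parameter.
\<close>
definition same_signs :: "('e \<Rightarrow> real) set \<Rightarrow> 'e \<Rightarrow> 'e \<Rightarrow> bool" where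
  "same_signs F e e' \<longleftrightarrow> (\<forall>f\<in>F. sgn (f e) = sgn (f e'))"

lemma same_signs_mono: "same_signs F e e' \<Longrightarrow> G \<subseteq> F \<Longrightarrow> same_signs G e e'"
  by (auto simp: same_signs_def)

lemma same_signs_Un: "same_signs (F \<union> G) e e' \<longleftrightarrow> same_signs F e e' \<and> same_signs G e e'"
  by (auto simp: same_signs_def)

locale real_function_ring =
  fixes R :: "('e \<Rightarrow> real) set"
  assumes const_mem: "(\<lambda>e. c) \<in> R"
    and add_mem: "f \<in> R \<Longrightarrow> g \<in> R \<Longrightarrow> (\<lambda>e. f e + g e) \<in> R"
    and mult_mem: "f \<in> R \<Longrightarrow> g \<in> R \<Longrightarrow> (\<lambda>e. f e * g e) \<in> R"
begin

text \<open>
  For a predicate \<open>g\<close> this says that the set where \<open>g\<close> holds is a finite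
  Boolean combination of sign conditions on members of \<open>R\<close>. Allowing values in any
  type lets degrees and whole sign tables be handled in the same way as predicates, and makes
  closure under all operations immediate.
\<close>
definition sign_determined :: "('e \<Rightarrow> 'b) \<Rightarrow> bool" where
  "sign_determined g \<longleftrightarrow>
    (\<exists>F. finite F \<and> F \<subseteq> R \<and> (\<forall>e e'. same_signs F e e' \<longrightarrow> g e = g e'))"

text \<open>
  The function \<open>t\<close> agrees on each sign class of \<open>F\<close> with a member of
  \<open>F\<close>. Using one set both for the case distinction and for the pieces costs nothing,
  as \<open>F\<close> may be enlarged. Unlike \<open>R\<close>, the piecewise functions are closed
  under case distinctions, so that the leading coefficient of a polynomial whose degree varies
  with the parameter is one of them.
\<close>
definition piecewise :: "('e \<Rightarrow> real) \<Rightarrow> bool" where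
  "piecewise t \<longleftrightarrow>
    (\<exists>F. finite F \<and> F \<subseteq> R \<and> (\<forall>e0. \<exists>f\<in>F. \<forall>e. same_signs F e0 e \<longrightarrow> t e = f e))"

definition piecewise_poly :: "('e \<Rightarrow> real poly) \<Rightarrow> bool" where
  "piecewise_poly p \<longleftrightarrow>
    (\<forall>i. piecewise (\<lambda>e. coeff (p e) i)) \<and> (\<exists>N. \<forall>e. degree (p e) \<le> N)"

lemma piecewiseI:
  assumes "finite F" "F \<subseteq> R" "\<And>e0. \<exists>f\<in>F. \<forall>e. same_signs F e0 e \<longrightarrow> t e = f e"
  shows "piecewise t"
  unfolding piecewise_def using assms by (intro exI[of _ F]) simp

lemma sign_determined_const: "sign_determined (\<lambda>e. c)"
  unfolding sign_determined_def by (intro exI[of _ "{}"]) simp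

lemma sign_determined_map: "sign_determined g \<Longrightarrow> sign_determined (\<lambda>e. h (g e))"
  unfolding sign_determined_def by metis

lemma sign_determined_map2:
  assumes "sign_determined g1" "sign_determined g2"
  shows "sign_determined (\<lambda>e. h (g1 e) (g2 e))"
proof -
  from assms obtain F1 F2 where F: "finite F1" "F1 \<subseteq> R" "finite F2" "F2 \<subseteq> R"
    and *: "\<And>e e'. same_signs F1 e e' \<Longrightarrow> g1 e = g1 e'" "\<And>e e'. same_signs F2 e e' \<Longrightarrow> g2 e = g2 e'"
    unfolding sign_determined_def by metis
  have "h (g1 e) (g2 e) = h (g1 e') (g2 e')" if "same_signs (F1 \<union> F2) e e'" for e e'
    using *(1)[of e e'] *(2)[of e e'] same_signs_mono[OF that] by simp
  with F show ?thesis unfolding sign_determined_def by (intro exI[of _ "F1 \<union> F2"]) simp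
qed

lemma sign_determined_family:
  assumes "finite S" "\<And>s. s \<in> S \<Longrightarrow> sign_determined (g s)"
  shows "sign_determined (\<lambda>e s. if s \<in> S then g s e else c)"
  using assms
proof (induction S rule: finite_induct)
  case empty
  then show ?case by (simp add: sign_determined_const)
next
  case (insert x S)
  have "(\<lambda>e s. if s \<in> insert x S then g s e else c) =
      (\<lambda>e. (\<lambda>s. if s \<in> S then g s e else c)(x := g x e))"
    by (intro ext) auto
  moreover have "sign_determined (\<lambda>e. (\<lambda>s. if s \<in> S then g s e else c)(x := g x e))"
    by (rule sign_determined_map2[where h = "\<lambda>l y. l(x := y)"]) (use insert in simp_all)
  ultimately show ?case by simp
qed

lemma piecewise_ring: "f \<in> R \<Longrightarrow> piecewise f"
  unfolding piecewise_def by (intro exI[of _ "{f}"]) simp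

lemma piecewise_map2:
  assumes "piecewise s" "piecewise t" and closed: "\<And>f g. f \<in> R \<Longrightarrow> g \<in> R \<Longrightarrow> (\<lambda>e. h (f e) (g e)) \<in> R"
  shows "piecewise (\<lambda>e. h (s e) (t e))"
proof -
  from assms(1) obtain F where F: "finite F" "F \<subseteq> R"
    "\<And>e0. \<exists>f\<in>F. \<forall>e. same_signs F e0 e \<longrightarrow> s e = f e" unfolding piecewise_def by metis
  from assms(2) obtain G where G: "finite G" "G \<subseteq> R"
    "\<And>e0. \<exists>g\<in>G. \<forall>e. same_signs G e0 e \<longrightarrow> t e = g e" unfolding piecewise_def by metis
  let ?H = "F \<union> G \<union> (\<lambda>(f, g) e. h (f e) (g e)) ` (F \<times> G)"
  have "\<exists>k\<in>?H. \<forall>e. same_signs ?H e0 e \<longrightarrow> h (s e) (t e) = k e" for e0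
  proof -
    obtain f g where fg: "f \<in> F" "\<And>e. same_signs F e0 e \<Longrightarrow> s e = f e"
      "g \<in> G" "\<And>e. same_signs G e0 e \<Longrightarrow> t e = g e" using F(3)[of e0] G(3)[of e0] by blast
    have "h (s e) (t e) = h (f e) (g e)" if "same_signs ?H e0 e" for e
      using fg(2)[of e] fg(4)[of e] that unfolding same_signs_Un by simp
    moreover have "(\<lambda>e. h (f e) (g e)) \<in> ?H" using fg(1,3) by force
    ultimately show ?thesis by (intro bexI[of _ "\<lambda>e. h (f e) (g e)"]) simp_all
  qed
  moreover have "finite ?H" "?H \<subseteq> R" using F(1,2) G(1,2) by (auto intro!: closed)
  ultimately show ?thesis by (intro piecewiseI[of ?H])
qed

lemmas piecewise_add = piecewise_map2[where h = "(+)", OF _ _ add_mem]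
lemmas piecewise_mult = piecewise_map2[where h = "(*)", OF _ _ mult_mem]

lemma piecewise_diff: "piecewise s \<Longrightarrow> piecewise t \<Longrightarrow> piecewise (\<lambda>e. s e - t e)"
proof -
  assume s: "piecewise s" and t: "piecewise t"
  have "piecewise (\<lambda>e. s e + (-1) * t e)"
    by (rule piecewise_add[OF s piecewise_mult[OF piecewise_ring[OF const_mem] t]])
  then show ?thesis by simp
qed

lemma piecewise_if:
  assumes "sign_determined c" "piecewise s" "piecewise t"
  shows "piecewise (\<lambda>e. if c e then s e else t e)"
proof -
  from assms(2) obtain F where F: "finite F" "F \<subseteq> R"
    "\<And>e0. \<exists>f\<in>F. \<forall>e. same_signs F e0 e \<longrightarrow> s e = f e" unfolding piecewise_def by metis
  from assms(3) obtain G where G: "finite G" "G \<subseteq> R"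
    "\<And>e0. \<exists>g\<in>G. \<forall>e. same_signs G e0 e \<longrightarrow> t e = g e" unfolding piecewise_def by metis
  from assms(1) obtain C where C: "finite C" "C \<subseteq> R"
    "\<And>e e'. same_signs C e e' \<Longrightarrow> c e = c e'" unfolding sign_determined_def by metis
  let ?H = "C \<union> F \<union> G"
  have "\<exists>k\<in>?H. \<forall>e. same_signs ?H e0 e \<longrightarrow> (if c e then s e else t e) = k e" for e0
  proof -
    obtain f g where fg: "f \<in> F" "\<And>e. same_signs F e0 e \<Longrightarrow> s e = f e"
      "g \<in> G" "\<And>e. same_signs G e0 e \<Longrightarrow> t e = g e" using F(3)[of e0] G(3)[of e0] by blast
    have "(if c e then s e else t e) = (if c e0 then f e else g e)" if "same_signs ?H e0 e" for e
      using C(3)[of e0 e] fg(2)[of e] fg(4)[of e] that unfolding same_signs_Un by simp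
    moreover have "(\<lambda>e. if c e0 then f e else g e) \<in> ?H" using fg(1,3) by (cases "c e0") simp_all
    ultimately show ?thesis by (intro bexI[of _ "\<lambda>e. if c e0 then f e else g e"]) simp_all
  qed
  moreover have "finite ?H" "?H \<subseteq> R" using F G C by auto
  ultimately show ?thesis by (intro piecewiseI[of ?H])
qed

lemma piecewise_select:
  assumes "sign_determined g" "\<And>e. g e \<le> (N::nat)" "\<And>k. piecewise (h k)"
  shows "piecewise (\<lambda>e. h (g e) e)"
  using assms(1,2)
proof (induction N arbitrary: g)
  case 0
  then show ?case using assms(3) by simp
next
  case (Suc N)
  have "piecewise (\<lambda>e. if g e = Suc N then h (Suc N) e else h (min (g e) N) e)"
    by (intro piecewise_if Suc.IH assms(3) sign_determined_map[OF Suc.prems(1)]) auto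
  moreover have "(if g e = Suc N then h (Suc N) e else h (min (g e) N) e) = h (g e) e" for e
    using Suc.prems(2)[of e] by (simp add: min_def)
  ultimately show ?case by simp
qed

lemma sign_determined_sgn:
  assumes "piecewise t"
  shows "sign_determined (\<lambda>e. sgn (t e))"
proof -
  from assms obtain F where F: "finite F" "F \<subseteq> R"
    "\<And>e0. \<exists>f\<in>F. \<forall>e. same_signs F e0 e \<longrightarrow> t e = f e" unfolding piecewise_def by metis
  have "sgn (t e) = sgn (t e')" if ss: "same_signs F e e'" for e e'
  proof -
    obtain f where "f \<in> F" "\<And>e'. same_signs F e e' \<Longrightarrow> t e' = f e'" using F(3)[of e] by blast
    with ss show ?thesis by (metis same_signs_def)
  qed
  with F show ?thesis unfolding sign_determined_def by blast
qed

lemma piecewise_polyD: "piecewise_poly p \<Longrightarrow> piecewise (\<lambda>e. coeff (p e) i)"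
  by (simp add: piecewise_poly_def)

text \<open>
  The degree depends only on which coefficients vanish.
\<close>
lemma sign_determined_degree:
  assumes "piecewise_poly p"
  shows "sign_determined (\<lambda>e. degree (p e))"
proof -
  obtain N where N: "\<And>e. degree (p e) \<le> N" using assms by (auto simp: piecewise_poly_def)
  define S where "S = (\<lambda>e i. if i \<in> {..N} then sgn (coeff (p e) i) else 0)"
  have "sign_determined S"
    unfolding S_def by (rule sign_determined_family) (auto intro!: sign_determined_sgn piecewise_polyD assms)
  then have "sign_determined (\<lambda>e. LEAST n. \<forall>i>n. S e i = 0)" by (rule sign_determined_map)
  moreover have "S e i = 0 \<longleftrightarrow> coeff (p e) i = 0" for e i
    using coeff_eq_0[of "p e" i] N[of e] by (auto simp: S_def sgn_zero_iff)
  ultimately show ?thesis by (simp add: Polynomial.degree_def)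
qed

lemma piecewise_lead_coeff: "piecewise_poly p \<Longrightarrow> piecewise (\<lambda>e. lead_coeff (p e))"
proof -
  assume p: "piecewise_poly p"
  then obtain N where N: "\<And>e. degree (p e) \<le> N" by (auto simp: piecewise_poly_def)
  show ?thesis
    by (rule piecewise_select[where h = "\<lambda>k e. coeff (p e) k", OF sign_determined_degree[OF p] N
          piecewise_polyD[OF p]])
qed

lemma piecewise_poly_zero: "piecewise_poly (\<lambda>e. 0)"
  by (simp add: piecewise_poly_def piecewise_ring const_mem)

lemma piecewise_poly_if:
  assumes "sign_determined c" "piecewise_poly p" "piecewise_poly q"
  shows "piecewise_poly (\<lambda>e. if c e then p e else q e)"
proof -
  obtain N M where "\<And>e. degree (p e) \<le> N" "\<And>e. degree (q e) \<le> M"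
    using assms by (auto simp: piecewise_poly_def)
  then have "degree (if c e then p e else q e) \<le> max N M" for e by (simp add: le_max_iff_disj)
  moreover have "piecewise (\<lambda>e. coeff (if c e then p e else q e) i)" for i
    unfolding if_distrib[of coeff] if_distribR
    by (rule piecewise_if[OF assms(1) piecewise_polyD[OF assms(2)] piecewise_polyD[OF assms(3)]])
  ultimately show ?thesis unfolding piecewise_poly_def by blast
qed

lemma piecewise_poly_diff:
  assumes "piecewise_poly p" "piecewise_poly q"
  shows "piecewise_poly (\<lambda>e. p e - q e)"
proof -
  obtain N M where "\<And>e. degree (p e) \<le> N" "\<And>e. degree (q e) \<le> M"
    using assms by (auto simp: piecewise_poly_def)
  then have "degree (p e - q e) \<le> max N M" for e by (intro degree_diff_le) (simp_all add: le_max_iff_disj)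
  moreover have "piecewise (\<lambda>e. coeff (p e - q e) i)" for i
    unfolding coeff_diff by (rule piecewise_diff[OF piecewise_polyD[OF assms(1)] piecewise_polyD[OF assms(2)]])
  ultimately show ?thesis unfolding piecewise_poly_def by blast
qed

lemma piecewise_sum:
  assumes "\<And>s. s \<in> S \<Longrightarrow> piecewise (t s)"
  shows "piecewise (\<lambda>e. \<Sum>s\<in>S. t s e)"
  using assms
proof (induction S rule: infinite_finite_induct)
  case (insert x S)
  have "piecewise (\<lambda>e. t x e + (\<Sum>s\<in>S. t s e))"
    by (rule piecewise_add) (rule insert | simp)+
  then show ?case using insert.hyps by simp
next
  case empty
  show ?case unfolding sum.empty by (rule piecewise_ring[OF const_mem])
next
  case infinite
  then show ?case unfolding sum.infinite[OF infinite.hyps] by (intro piecewise_ring const_mem)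
qed

lemma piecewise_poly_add:
  assumes "piecewise_poly p" "piecewise_poly q"
  shows "piecewise_poly (\<lambda>e. p e + q e)"
proof -
  obtain N M where "\<And>e. degree (p e) \<le> N" "\<And>e. degree (q e) \<le> M"
    using assms by (auto simp: piecewise_poly_def)
  then have "degree (p e + q e) \<le> max N M" for e by (rule degree_add_le[OF max.coboundedI1 max.coboundedI2])
  moreover have "piecewise (\<lambda>e. coeff (p e + q e) i)" for i
    unfolding coeff_add by (rule piecewise_add[OF piecewise_polyD[OF assms(1)] piecewise_polyD[OF assms(2)]])
  ultimately show ?thesis unfolding piecewise_poly_def by blast
qed

lemma piecewise_poly_mult:
  assumes "piecewise_poly p" "piecewise_poly q"
  shows "piecewise_poly (\<lambda>e. p e * q e)"
proof -
  obtain N M where "\<And>e. degree (p e) \<le> N" "\<And>e. degree (q e) \<le> M"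
    using assms by (auto simp: piecewise_poly_def)
  then have "degree (p e * q e) \<le> N + M" for e
    by (rule order_trans[OF degree_mult_le add_mono])
  moreover have "piecewise (\<lambda>e. coeff (p e * q e) i)" for i
    unfolding coeff_mult 
    by (rule piecewise_sum, rule piecewise_mult[OF piecewise_polyD[OF assms(1)] piecewise_polyD[OF assms(2)]])
  ultimately show ?thesis unfolding piecewise_poly_def by blast
qed

lemma piecewise_poly_pCons:
  assumes "piecewise a" "piecewise_poly p"
  shows "piecewise_poly (\<lambda>e. pCons (a e) (p e))"
proof -
  obtain N where "\<And>e. degree (p e) \<le> N" using assms by (auto simp: piecewise_poly_def)
  then have "degree (pCons (a e) (p e)) \<le> Suc N" for e
    by (intro order_trans[OF degree_pCons_le]) simp
  moreover have "piecewise (\<lambda>e. coeff (pCons (a e) (p e)) i)" for i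
  proof (cases i)
    case 0
    then show ?thesis using assms(1) by simp
  next
    case (Suc j)
    then show ?thesis using piecewise_polyD[OF assms(2), of j] by simp
  qed
  ultimately show ?thesis unfolding piecewise_poly_def by blast
qed

lemma piecewise_poly_smult:
  assumes "piecewise a" "piecewise_poly p"
  shows "piecewise_poly (\<lambda>e. smult (a e) (p e))"
proof -
  have "piecewise (\<lambda>e. coeff (smult (a e) (p e)) i)" for i
    unfolding coeff_smult by (rule piecewise_mult[OF assms(1) piecewise_polyD[OF assms(2)]])
  moreover obtain N where "\<And>e. degree (p e) \<le> N" using assms by (auto simp: piecewise_poly_def)
  then have "degree (smult (a e) (p e)) \<le> N" for e by (rule order_trans[OF degree_smult_le])
  ultimately show ?thesis unfolding piecewise_poly_def by blast
qed

lemma piecewise_poly_pderiv: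
  assumes "piecewise_poly p"
  shows "piecewise_poly (\<lambda>e. pderiv (p e))"
proof -
  have "piecewise (\<lambda>e. coeff (pderiv (p e)) i)" for i
    unfolding coeff_pderiv
    by (rule piecewise_mult[OF piecewise_ring[OF const_mem] piecewise_polyD[OF assms]])
  moreover obtain N where "\<And>e. degree (p e) \<le> N" using assms by (auto simp: piecewise_poly_def)
  then have "degree (pderiv (p e)) \<le> N" for e unfolding degree_pderiv by (meson diff_le_self order_trans)
  ultimately show ?thesis unfolding piecewise_poly_def by blast
qed

lemma piecewise_poly_shift:
  assumes "sign_determined g" "\<And>e. g e \<le> (N::nat)" "piecewise_poly p"
  shows "piecewise_poly (\<lambda>e. monom 1 (g e) * p e)"
proof -
  obtain M where M: "\<And>e. degree (p e) \<le> M" using assms by (auto simp: piecewise_poly_def)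
  have "degree (monom 1 (g e) * p e) \<le> N + M" for e
    by (rule order_trans[OF degree_mult_le]) (intro add_mono order_trans[OF degree_monom_le] assms(2) M)
  moreover have "piecewise (\<lambda>e. coeff (monom 1 (g e) * p e) i)" for i
  proof (rule piecewise_select[where h = "\<lambda>k e. coeff (monom 1 k * p e) i", OF assms(1,2)])
    show "piecewise (\<lambda>e. coeff (monom 1 k * p e) i)" for k
      using piecewise_polyD[OF assms(3)] piecewise_ring[OF const_mem]
      by (cases "k \<le> i") (simp_all add: coeff_monom_mult)
  qed
  ultimately show ?thesis unfolding piecewise_poly_def by blast
qed

end

section \<open>Elimination of a real quantifier\<close>

text \<open>
  One step of pseudo-division of \<open>q\<close> by \<open>j\<close>, multiplied once more by the
  leading coefficient of \<open>j\<close>. At a root of \<open>j\<close> its value is then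
  \<open>q\<close> times a square, so its sign there is the sign of \<open>q\<close> whatever the
  sign of the leading coefficient. A single step is enough, because the
  result only has to have smaller degree than \<open>q\<close>. Where \<open>q\<close> has smaller degree there is nothing to
  reduce.
\<close>
definition reduct :: "nat \<Rightarrow> ('e \<Rightarrow> real poly) \<Rightarrow> ('e \<Rightarrow> real poly) \<Rightarrow> 'e \<Rightarrow> real poly" where
  "reduct n q j e = (if degree (q e) = Suc n then
      smult (lead_coeff (j e)) (smult (lead_coeff (j e)) (q e) -
        smult (lead_coeff (q e)) (monom 1 (Suc n - degree (j e)) * j e))
    else 0)"

lemma degree_reduct_le:
  assumes "degree (j e) \<le> Suc n"
  shows "degree (reduct n q j e) \<le> n"
proof (cases "degree (q e) = Suc n \<and> j e \<noteq> 0")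
  case True
  let ?d = "smult (lead_coeff (j e)) (q e) -
        smult (lead_coeff (q e)) (monom 1 (Suc n - degree (j e)) * j e)"
  have "degree (monom 1 (Suc n - degree (j e)) * j e) \<le> Suc n"
    by (rule order_trans[OF degree_mult_le]) (use assms in \<open>simp add: degree_monom_eq\<close>)
  then have "degree ?d \<le> Suc n"
    using True by (intro degree_diff_le order_trans[OF degree_smult_le]) auto
  moreover have "coeff ?d (Suc n) = 0" using assms True by (simp add: coeff_monom_mult)
  ultimately have "coeff ?d i = 0" if "n < i" for i
    using that coeff_eq_0[of ?d i] by (cases "i = Suc n") simp_all
  then have "degree ?d \<le> n" by (intro degree_le) blast
  then show ?thesis using True by (simp add: reduct_def)
qed (auto simp: reduct_def)

lemma sgn_reduct_at_root:
  assumes "degree (q e) = Suc n" "j e \<noteq> 0" "poly (j e) b = 0"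
  shows "sgn (poly (reduct n q j e) b) = sgn (poly (q e) b)"
proof -
  let ?c = "lead_coeff (j e)"
  have "poly (reduct n q j e) b = (?c * ?c) * poly (q e) b"
    using assms by (simp add: reduct_def)
  moreover have "?c * ?c > 0" using assms(2) by (simp add: zero_less_mult_iff less_le)
  ultimately show ?thesis by (metis sgn_mult sgn_pos mult_1)
qed

context real_function_ring
begin

lemma piecewise_poly_reduct:
  assumes "piecewise_poly q" "piecewise_poly j"
  shows "piecewise_poly (reduct n q j)"
proof -
  have "piecewise_poly (\<lambda>e. if degree (q e) = Suc n then
      smult (lead_coeff (j e)) (smult (lead_coeff (j e)) (q e) -
        smult (lead_coeff (q e)) (monom 1 (Suc n - degree (j e)) * j e))
    else 0)"
    by (intro piecewise_poly_if piecewise_poly_smult piecewise_poly_diff piecewise_poly_zero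
        piecewise_lead_coeff assms
        piecewise_poly_shift[where g = "\<lambda>e. Suc n - degree (j e)" and N = "Suc n"]
        sign_determined_map[OF sign_determined_degree[OF assms(1)], of "\<lambda>k. k = Suc n"]
        sign_determined_map[OF sign_determined_degree[OF assms(2)], of "\<lambda>k. Suc n - k"]) simp
  then show ?thesis by (simp only: reduct_def[abs_def])
qed

text \<open>
  Index and polynomial coincide here: the family is indexed by the parametrised polynomials
  themselves, and \<open>\<lambda>p. p e\<close> specialises all of them to the parameter
  \<open>e\<close>.
\<close>
definition tabulated :: "('e \<Rightarrow> real poly) set \<Rightarrow> bool" where
  "tabulated I \<longleftrightarrow> (\<exists>D. sign_determined D \<and>
    (\<forall>e. table (signs I (\<lambda>p. p e)) (signs I (\<lambda>p. p e)) (-\<infinity>) (fst (D e)) (snd (D e))))"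

lemma tabulated_constant:
  assumes "finite I" "\<And>p. p \<in> I \<Longrightarrow> piecewise_poly p" "\<And>p e. p \<in> I \<Longrightarrow> degree (p e) = 0"
  shows "tabulated I"
proof -
  define D where "D = (\<lambda>e p. if p \<in> I then sgn (coeff (p e) 0) else 0)"
  have "sign_determined D"
    unfolding D_def
    by (rule sign_determined_family[OF assms(1)]) (intro sign_determined_sgn piecewise_polyD assms(2))
  then have "sign_determined (\<lambda>e. (D e, []))" by (rule sign_determined_map)
  moreover have "signs I (\<lambda>p. p e) x = D e" for e x
  proof -
    have "poly (p e) x = coeff (p e) 0" if "p \<in> I" for p
      using degree_eq_zeroE[OF assms(3)[OF that, of e]] by fastforce
    then show ?thesis by (auto simp: signs_def D_def)
  qed
  ultimately show ?thesis unfolding tabulated_def by (intro exI[of _ "\<lambda>e. (D e, [])"]) simp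
qed

text \<open>
  The inductive step of the Cohen-Hoermander elimination. From a table that covers the derivative
  of \<open>q\<close>, a family \<open>H\<close>, and the reducts of \<open>q\<close> by all of
  these, the table of \<open>q\<close> and \<open>H\<close> is computed by a combinatorial recipe
  that looks at the parameter only through the degree of \<open>q\<close>: read off the sign of \<open>q\<close> at the roots of the
  others from the reducts, forget the reducts, and insert the roots of \<open>q\<close>. For
  parameters where the degree of \<open>q\<close> drops, \<open>q\<close> equals the member
  \<open>low\<close> of the given family.
\<close>
lemma tabulated_extend:
  fixes n :: nat and q :: "'e \<Rightarrow> real poly" and H :: "('e \<Rightarrow> real poly) set"
  defines "dq \<equiv> (\<lambda>e. pderiv (q e))" and "low \<equiv> (\<lambda>e. if degree (q e) \<le> n then q e else 0)"
  defines "J \<equiv> insert dq H"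
  assumes I: "tabulated I" "J \<subseteq> I" "reduct n q ` J \<subseteq> I" "low \<in> I"
    and q: "piecewise_poly q" "\<And>e. degree (q e) \<le> Suc n"
  shows "tabulated (insert q H)"
proof -
  from I(1) obtain D where D: "sign_determined D"
    "\<And>e. table (signs I (\<lambda>p. p e)) (signs I (\<lambda>p. p e)) (-\<infinity>) (fst (D e)) (snd (D e))"
    unfolding tabulated_def by blast
  \<comment> \<open>Near minus infinity a nonconstant polynomial has the sign opposite to that of its derivative: the start sign of the refinement.\<close>
  define high where "high = (\<lambda>(v, T).
    let r = refine q dq (- v dq) (restrict_to J v) (coarsen q J (reduct n q) T)
    in map_prod (restrict_to (insert q H))
         (map (map_prod (restrict_to (insert q H)) (restrict_to (insert q H)))) r)"
  \<comment> \<open>Applied where the degree of q is at most n; there the sign of q is listed under low.\<close>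
  define lowdeg where "lowdeg = (\<lambda>w. (restrict_to H w)(q := w low))"
  define D' where "D' = (\<lambda>e. if degree (q e) = Suc n then high (D e)
    else map_prod lowdeg (map (map_prod lowdeg lowdeg)) (D e))"
  have "sign_determined (\<lambda>e. (\<lambda>k d. if k = Suc n then high d
      else map_prod lowdeg (map (map_prod lowdeg lowdeg)) d) (degree (q e)) (D e))"
    by (rule sign_determined_map2[OF sign_determined_degree[OF q(1)] D(1)])
  then have "sign_determined D'" by (simp add: D'_def)
  moreover have "table (signs (insert q H) (\<lambda>p. p e)) (signs (insert q H) (\<lambda>p. p e)) (-\<infinity>)
      (fst (D' e)) (snd (D' e))" for e
  proof (cases "degree (q e) = Suc n")
    case False
    then have le: "degree (q e) \<le> n" using q(2)[of e] by simp
    have "signs (insert q H) (\<lambda>p. p e) x = lowdeg (signs I (\<lambda>p. p e) x)" for x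
    proof -
      have "H \<subseteq> I" using I(2) by (auto simp: J_def)
      then show ?thesis
        using I(4) le by (simp add: signs_insert lowdeg_def signs_restrict[OF \<open>H \<subseteq> I\<close>])
          (simp add: signs_def low_def)
    qed
    note eq = this
    have "table (signs (insert q H) (\<lambda>p. p e)) (signs (insert q H) (\<lambda>p. p e)) (-\<infinity>)
      (lowdeg (fst (D e))) (map (map_prod lowdeg lowdeg) (snd (D e)))"
      by (rule table_map[where f = lowdeg and g = lowdeg, OF D(2)[of e]]) (rule eq)+
    then show ?thesis using False by (simp add: D'_def)
  next
    case True
    obtain v T where vT: "D e = (v, T)" by (cases "D e")
    let ?p = "\<lambda>p :: 'e \<Rightarrow> real poly. p e"
    have tab: "table (signs I ?p) (signs I ?p) (-\<infinity>) v T" using D(2)[of e] vT by simp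
    have coarse: "table (signs (insert q J) ?p) (signs J ?p) (-\<infinity>) (restrict_to J v)
        (coarsen q J (reduct n q) T)"
      by (rule table_coarsen[OF tab _ I(2)]) (use I(3) True in \<open>auto simp: sgn_reduct_at_root\<close>)
    have dqJ: "dq \<in> J" by (simp add: J_def)
    obtain b where b: "-\<infinity> < b" "\<And>x. -\<infinity> < ereal x \<Longrightarrow> ereal x < b \<Longrightarrow> signs I ?p x = v"
      using table_first_cell[OF tab] by auto
    obtain \<beta> where \<beta>: "ereal \<beta> < b" using ereal_interval_nonempty[OF b(1)] by blast
    have dsgn: "sgn (poly (pderiv (q e)) x) = v dq" if "ereal x < b" for x
      using fun_cong[OF b(2), of x dq] that dqJ I(2) by (auto simp: signs_def dq_def)
    have "v dq \<noteq> 0"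
    proof
      assume "v dq = 0"
      have "pderiv (q e) = 0"
        by (rule poly_zero_on_interval[OF b(1)]) (use dsgn \<open>v dq = 0\<close> in \<open>simp add: sgn_zero_iff\<close>)
      then show False using True by (simp add: pderiv_eq_0_iff)
    qed
    have "\<exists>c. \<forall>x<c. sgn (poly (q e) x) = - v dq"
      by (rule sgn_poly_near_minus_infinity[of _ \<beta>])
        (use True dsgn ereal_less_mono(2)[OF \<beta>] in auto)
    then obtain c where "\<forall>x<c. sgn (poly (q e) x) = - v dq" by blast
    then have germ: "\<exists>c>-\<infinity>. \<forall>x. -\<infinity> < ereal x \<and> ereal x < c \<longrightarrow> sgn (poly (q e) x) = - v dq"
      by (intro exI[of _ "ereal c"]) simp
    let ?r = "refine q dq (- v dq) (restrict_to J v) (coarsen q J (reduct n q) T)"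
    have "table (signs (insert q J) ?p) (signs (insert q J) ?p) (-\<infinity>) (fst ?r) (snd ?r)"
      by (rule table_refine[where p = ?p and q = q, OF coarse _ dqJ _ _ germ]) (use True \<open>v dq \<noteq> 0\<close> in \<open>simp_all add: dq_def\<close>)
    from table_map[OF this, where f = "restrict_to (insert q H)" and g = "restrict_to (insert q H)"
        and \<phi>' = "signs (insert q H) ?p" and \<psi>' = "signs (insert q H) ?p"]
    have "table (signs (insert q H) ?p) (signs (insert q H) ?p) (-\<infinity>) (restrict_to (insert q H) (fst ?r))
        (map (map_prod (restrict_to (insert q H)) (restrict_to (insert q H))) (snd ?r))"
      using signs_restrict[of "insert q H" "insert q J"] by (auto simp: J_def)
    then show ?thesis using True vT by (simp add: D'_def high_def Let_def)
  qed
  ultimately show ?thesis unfolding tabulated_def by blast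
qed

text \<open>
  Outer induction on a bound for the degrees; inner induction on the set \<open>G\<close> of those
  polynomials that may attain the bound, for all sets \<open>F\<close> of polynomials of smaller
  degree. Treating one member \<open>q\<close> of \<open>G\<close> trades it for finitely many
  polynomials of smaller degree (the derivative, the reducts and the truncation), which are
  absorbed into \<open>F\<close>.
\<close>
theorem tabulated_piecewise_poly:
  assumes "finite I" "\<And>p. p \<in> I \<Longrightarrow> piecewise_poly p" "\<And>p e. p \<in> I \<Longrightarrow> degree (p e) \<le> n"
  shows "tabulated I"
  using assms
proof (induction n arbitrary: I)
  case 0
  then show ?case by (intro tabulated_constant) auto
next
  case (Suc n)
  have "tabulated (F \<union> G)"
    if "finite G" "finite F" "\<And>p. p \<in> F \<union> G \<Longrightarrow> piecewise_poly p"
      "\<And>p e. p \<in> F \<Longrightarrow> degree (p e) \<le> n" "\<And>p e. p \<in> G \<Longrightarrow> degree (p e) \<le> Suc n" for F G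
    using that
  proof (induction G arbitrary: F rule: finite_induct)
    case empty
    then show ?case using Suc.IH[of F] by simp
  next
    case (insert q G)
    define dq where "dq = (\<lambda>e. pderiv (q e))"
    define low where "low = (\<lambda>e. if degree (q e) \<le> n then q e else 0)"
    define J where "J = insert dq (F \<union> G)"
    define F' where "F' = insert dq F \<union> reduct n q ` J \<union> {low}"
    have q: "piecewise_poly q" "\<And>e. degree (q e) \<le> Suc n" using insert.prems by auto
    have dq: "degree (dq e) \<le> n" for e using q(2)[of e] by (simp add: dq_def degree_pderiv)
    have pw_J: "piecewise_poly p" if "p \<in> J" for p
      using that insert.prems(2) q(1) by (auto simp: J_def dq_def intro: piecewise_poly_pderiv)
    have deg_J: "degree (p e) \<le> Suc n" if "p \<in> J" for p e
      using that insert.prems(3)[of p e] insert.prems(4)[of p e] dq[of e] by (auto simp: J_def)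
    have deg_red: "degree (reduct n q p e) \<le> n" if "p \<in> J" for p e
      by (rule degree_reduct_le[of p e n q, OF deg_J[OF that]])
    have pw_low: "piecewise_poly low" unfolding low_def
      by (intro piecewise_poly_if piecewise_poly_zero q(1)
          sign_determined_map[OF sign_determined_degree[OF q(1)], of "\<lambda>k. k \<le> n"])
    have "tabulated (F' \<union> G)"
    proof (rule insert.IH)
      show "finite F'" using insert.prems(1) insert.hyps(1) by (simp add: F'_def J_def)
      show "piecewise_poly p" if "p \<in> F' \<union> G" for p
        using that pw_J pw_low piecewise_poly_reduct[OF q(1)] by (auto simp: F'_def J_def)
      show "degree (p e) \<le> n" if "p \<in> F'" for p e
        using that dq insert.prems(3) deg_red by (auto simp: F'_def low_def)
      show "degree (p e) \<le> Suc n" if "p \<in> G" for p e using that insert.prems(4) by simp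
    qed
    then have "tabulated (insert q (F \<union> G))"
    proof (rule tabulated_extend[where n = n and q = q and H = "F \<union> G"])
      show "insert (\<lambda>e. pderiv (q e)) (F \<union> G) \<subseteq> F' \<union> G" by (auto simp: F'_def dq_def)
      show "reduct n q ` insert (\<lambda>e. pderiv (q e)) (F \<union> G) \<subseteq> F' \<union> G"
        unfolding F'_def J_def dq_def by blast
      show "(\<lambda>e. if degree (q e) \<le> n then q e else 0) \<in> F' \<union> G" by (simp add: F'_def low_def)
    qed (rule q)+
    then show ?case by simp
  qed
  from this[of I "{}"] Suc.prems show ?case by simp
qed

text \<open>
  Every sign vector that occurs is an entry of the table, so the existence of a point with
  prescribed signs can be read off from the table.
\<close>
theorem sign_determined_ex_poly:
  assumes "finite I" "\<And>p. p \<in> I \<Longrightarrow> piecewise_poly p"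
  shows "sign_determined (\<lambda>e. \<exists>x. Q (signs I (\<lambda>p. p e) x))"
proof -
  have "\<forall>p\<in>I. \<exists>N. \<forall>e. degree (p e) \<le> N" using assms(2) by (auto simp: piecewise_poly_def)
  then obtain N where N: "\<And>p e. p \<in> I \<Longrightarrow> degree (p e) \<le> N p" by metis
  have "tabulated I"
  proof (rule tabulated_piecewise_poly[OF assms])
    show "degree (p e) \<le> Max (N ` I)" if "p \<in> I" for p e
      using N[OF that, of e] Max_ge[of "N ` I" "N p"] that assms(1) by (auto intro: order_trans)
  qed
  then obtain D where D: "sign_determined D"
    "\<And>e. table (signs I (\<lambda>p. p e)) (signs I (\<lambda>p. p e)) (-\<infinity>) (fst (D e)) (snd (D e))"
    unfolding tabulated_def by blast
  have "(\<exists>x. Q (signs I (\<lambda>p. p e) x)) \<longleftrightarrow>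
      Q (fst (D e)) \<or> (\<exists>(w, u)\<in>set (snd (D e)). Q w \<or> Q u)" for e
    using table_realized[OF D(2)[of e], of Q] by simp
  then show ?thesis
    using sign_determined_map[OF D(1), of "\<lambda>d. Q (fst d) \<or> (\<exists>(w, u)\<in>set (snd d). Q w \<or> Q u)"] by simp
qed

end

section \<open>Semialgebraic predicates and the Tarski-Seidenberg theorem\<close>

text \<open>
  Polynomial functions of environments, that is, of assignments of real values to variables. A
  predicate that is sign determined over them is a semialgebraic one.
\<close>
inductive_set poly_functions :: "(('v \<Rightarrow> real) \<Rightarrow> real) set" where
  const: "(\<lambda>e. c) \<in> poly_functions"
| var: "(\<lambda>e. e v) \<in> poly_functions"
| add: "f \<in> poly_functions \<Longrightarrow> g \<in> poly_functions \<Longrightarrow> (\<lambda>e. f e + g e) \<in> poly_functions"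
| mult: "f \<in> poly_functions \<Longrightarrow> g \<in> poly_functions \<Longrightarrow> (\<lambda>e. f e * g e) \<in> poly_functions"

interpretation pf: real_function_ring poly_functions
  by standard (auto intro: poly_functions.intros)

abbreviation definable :: "(('v \<Rightarrow> real) \<Rightarrow> bool) \<Rightarrow> bool" where
  "definable \<equiv> pf.sign_determined"

lemma poly_function_in_variable:
  assumes "f \<in> poly_functions"
  shows "\<exists>p. pf.piecewise_poly p \<and> (\<forall>e x. f (e(k := x)) = poly (p e) x)"
  using assms
proof induction
  case (const c)
  have "pf.piecewise_poly (\<lambda>e. [:c:])"
    by (intro pf.piecewise_poly_pCons pf.piecewise_poly_zero pf.piecewise_ring poly_functions.const)
  then show ?case by (intro exI[of _ "\<lambda>e. [:c:]"]) simp
next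
  case (var v)
  show ?case
  proof (cases "v = k")
    case True
    have "pf.piecewise_poly (\<lambda>e. [:0, 1:])"
      by (intro pf.piecewise_poly_pCons pf.piecewise_poly_zero pf.piecewise_ring poly_functions.const)
    then show ?thesis using True by (intro exI[of _ "\<lambda>e. [:0, 1:]"]) simp
  next
    case False
    have "pf.piecewise_poly (\<lambda>e. [:e v:])"
      by (intro pf.piecewise_poly_pCons pf.piecewise_poly_zero pf.piecewise_ring poly_functions.var)
    then show ?thesis using False by (intro exI[of _ "\<lambda>e. [:e v:]"]) simp
  qed
next
  case (add f g)
  from add.IH obtain p q where "pf.piecewise_poly p" "\<forall>e x. f (e(k := x)) = poly (p e) x"
    "pf.piecewise_poly q" "\<forall>e x. g (e(k := x)) = poly (q e) x" by (elim exE conjE)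
  note pq = this
  have "pf.piecewise_poly (\<lambda>e. p e + q e)" by (rule pf.piecewise_poly_add[OF pq(1,3)])
  moreover have "f (e(k := x)) + g (e(k := x)) = poly (p e + q e) x" for e x
    by (simp only: pq(2,4) poly_add)
  ultimately show ?case by (intro exI[of _ "\<lambda>e. p e + q e"] conjI allI)
next
  case (mult f g)
  from mult.IH obtain p q where "pf.piecewise_poly p" "\<forall>e x. f (e(k := x)) = poly (p e) x"
    "pf.piecewise_poly q" "\<forall>e x. g (e(k := x)) = poly (q e) x" by (elim exE conjE)
  note pq = this
  have "pf.piecewise_poly (\<lambda>e. p e * q e)" by (rule pf.piecewise_poly_mult[OF pq(1,3)])
  moreover have "f (e(k := x)) * g (e(k := x)) = poly (p e * q e) x" for e x
    by (simp only: pq(2,4) poly_mult)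
  ultimately show ?case by (intro exI[of _ "\<lambda>e. p e * q e"] conjI allI)
qed

text \<open>
  The Tarski-Seidenberg theorem: the polynomials occurring in \<open>\<phi>\<close> are read as
  polynomials in the quantified variable whose coefficients are functions of the other variables.
\<close>
theorem definable_ex_variable:
  assumes "definable \<phi>"
  shows "definable (\<lambda>e. \<exists>x. \<phi> (e(k := x)))"
proof -
  from assms obtain F where F: "finite F" "F \<subseteq> poly_functions"
    "\<And>e e'. same_signs F e e' \<Longrightarrow> \<phi> e = \<phi> e'" unfolding pf.sign_determined_def by metis
  have "\<forall>f\<in>F. \<exists>p. pf.piecewise_poly p \<and> (\<forall>e x. f (e(k := x)) = poly (p e) x)"
    by (intro ballI poly_function_in_variable subsetD[OF F(2)])
  from bchoice[OF this] obtain p where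
    "\<forall>f\<in>F. pf.piecewise_poly (p f) \<and> (\<forall>e x. f (e(k := x)) = poly (p f e) x)" by (rule exE)
  then have p: "pf.piecewise_poly (p f)" "f (e(k := x)) = poly (p f e) x" if "f \<in> F" for f e x
    using that by simp_all
  define Q where "Q = (\<lambda>l. \<exists>e'. \<phi> e' \<and> (\<forall>f\<in>F. sgn (f e') = l (p f)))"
  have "Q (signs (p ` F) (\<lambda>p. p e) x) \<longleftrightarrow> \<phi> (e(k := x))" for e x
  proof -
    have "signs (p ` F) (\<lambda>p. p e) x (p f) = sgn (f (e(k := x)))" if "f \<in> F" for f
      unfolding p(2)[OF that] using that by (simp add: signs_def)
    then have "Q (signs (p ` F) (\<lambda>p. p e) x) \<longleftrightarrow> (\<exists>e'. \<phi> e' \<and> same_signs F e' (e(k := x)))"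
      by (simp add: Q_def same_signs_def)
    also have "\<dots> \<longleftrightarrow> \<phi> (e(k := x))"
    proof
      assume "\<exists>e'. \<phi> e' \<and> same_signs F e' (e(k := x))"
      then obtain e' where e': "\<phi> e'" "same_signs F e' (e(k := x))" by (elim exE conjE)
      from F(3)[OF e'(2)] e'(1) show "\<phi> (e(k := x))" by (rule iffD1)
    next
      assume "\<phi> (e(k := x))"
      then show "\<exists>e'. \<phi> e' \<and> same_signs F e' (e(k := x))"
        by (intro exI[of _ "e(k := x)"] conjI) (simp_all add: same_signs_def)
    qed
    finally show ?thesis .
  qed
  moreover have "definable (\<lambda>e. \<exists>x. Q (signs (p ` F) (\<lambda>p. p e) x))"
    by (rule pf.sign_determined_ex_poly) (use F(1) p(1) in auto)
  ultimately show ?thesis by simp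
qed

lemma definable_conj: "definable \<phi> \<Longrightarrow> definable \<psi> \<Longrightarrow> definable (\<lambda>e. \<phi> e \<and> \<psi> e)"
  by (rule pf.sign_determined_map2)

lemma definable_imp: "definable \<phi> \<Longrightarrow> definable \<psi> \<Longrightarrow> definable (\<lambda>e. \<phi> e \<longrightarrow> \<psi> e)"
  by (rule pf.sign_determined_map2)

lemma definable_nonneg: "f \<in> poly_functions \<Longrightarrow> definable (\<lambda>e. f e \<ge> 0)"
  using pf.sign_determined_map[OF pf.sign_determined_sgn[OF pf.piecewise_ring], of f "\<lambda>s. s \<ge> 0"]
  by simp

text \<open>
  Variables are grouped into numbered blocks of \<open>CARD('n)\<close> variables, so that a
  quantifier over vectors is a quantifier over one block.
\<close>
type_synonym 'n env = "nat \<times> 'n \<Rightarrow> real"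

definition block :: "nat \<Rightarrow> 'n env \<Rightarrow> real ^ 'n" where
  "block k e = (\<chi> i. e (k, i))"

definition set_block :: "nat \<Rightarrow> real ^ 'n \<Rightarrow> 'n env \<Rightarrow> 'n env" where
  "set_block k x e = (\<lambda>(j, i). if j = k then x $ i else e (j, i))"

lemma block_set_block [simp]: "block j (set_block k x e) = (if j = k then x else block j e)"
  by (simp add: block_def set_block_def vec_eq_iff)

text \<open>
  The components of the block are quantified one after the other.
\<close>
lemma definable_ex_block:
  fixes \<phi> :: "'n::finite env \<Rightarrow> bool"
  assumes "definable \<phi>"
  shows "definable (\<lambda>e. \<exists>x. \<phi> (set_block k x e))"
proof -
  have "definable (\<lambda>e. \<exists>x :: real ^ 'n. \<phi> (\<lambda>(j, l). if j = k \<and> l \<in> S then x $ l else e (j, l)))"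
    if "finite S" for S :: "'n set"
    using that
  proof (induction S rule: finite_induct)
    case empty
    then show ?case using assms by (simp add: case_prod_eta)
  next
    case (insert i S)
    let ?e = "\<lambda>S (x :: real ^ 'n) (e :: 'n env). (\<lambda>(j, l). if j = k \<and> l \<in> S then x $ l else e (j, l))"
    have 1: "?e (insert i S) x e = ?e S x (e((k, i) := x $ i))" for x e
      using insert.hyps by (auto simp: fun_eq_iff)
    have 2: "?e S x (e((k, i) := y)) = ?e (insert i S) (\<chi> l. if l = i then y else x $ l) e" for x e y
      using insert.hyps by (auto simp: fun_eq_iff)
    have "(\<exists>y x. \<phi> (?e S x (e((k, i) := y)))) \<longleftrightarrow> (\<exists>x. \<phi> (?e (insert i S) x e))" for e
    proof
      assume "\<exists>y x. \<phi> (?e S x (e((k, i) := y)))"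
      then obtain y x where "\<phi> (?e S x (e((k, i) := y)))" by (elim exE)
      then show "\<exists>x. \<phi> (?e (insert i S) x e)" unfolding 2 by (rule exI)
    next
      assume "\<exists>x. \<phi> (?e (insert i S) x e)"
      then obtain x where "\<phi> (?e (insert i S) x e)" by (elim exE)
      then show "\<exists>y x. \<phi> (?e S x (e((k, i) := y)))" unfolding 1 by (intro exI)
    qed
    with definable_ex_variable[OF insert.IH, of "(k, i)"] show ?case by (simp only:)
  qed
  from this[of UNIV] show ?thesis by (simp add: set_block_def)
qed

lemma definable_all_block:
  fixes \<phi> :: "'n::finite env \<Rightarrow> bool"
  assumes "definable \<phi>"
  shows "definable (\<lambda>e. \<forall>x. \<phi> (set_block k x e))"
proof -
  have "definable (\<lambda>e. \<not> (\<exists>x. \<not> \<phi> (set_block k x e)))"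
    by (intro pf.sign_determined_map[where h = Not] definable_ex_block assms)
  then show ?thesis by simp
qed

lemma poly_functions_diff:
  "f \<in> poly_functions \<Longrightarrow> g \<in> poly_functions \<Longrightarrow> (\<lambda>e. f e - g e) \<in> poly_functions"
  using poly_functions.add[OF _ poly_functions.mult[OF poly_functions.const[of "-1"]], of f g] by simp

lemma poly_functions_sum:
  "(\<And>s. s \<in> S \<Longrightarrow> f s \<in> poly_functions) \<Longrightarrow> (\<lambda>e. \<Sum>s\<in>S. f s e) \<in> poly_functions"
proof (induction S rule: infinite_finite_induct)
  case (insert x S)
  then show ?case using poly_functions.add[of "f x" "\<lambda>e. \<Sum>s\<in>S. f s e"] by simp
qed (simp_all add: poly_functions.const)

lemma poly_functions_prod:
  "(\<And>s. s \<in> S \<Longrightarrow> f s \<in> poly_functions) \<Longrightarrow> (\<lambda>e. \<Prod>s\<in>S. f s e) \<in> poly_functions"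
proof (induction S rule: infinite_finite_induct)
  case (insert x S)
  then show ?case using poly_functions.mult[of "f x" "\<lambda>e. \<Prod>s\<in>S. f s e"] by simp
qed (simp_all add: poly_functions.const)

lemma poly_functions_power: "f \<in> poly_functions \<Longrightarrow> (\<lambda>e. f e ^ m) \<in> poly_functions"
  by (induction m) (auto intro: poly_functions.const poly_functions.mult)

text \<open>
  The vector-valued terms from which the formulas below are built.
\<close>
definition poly_vector :: "('n env \<Rightarrow> real ^ 'n) \<Rightarrow> bool" where
  "poly_vector u \<longleftrightarrow> (\<forall>i. (\<lambda>e. u e $ i) \<in> poly_functions)"

lemma poly_vector_block: "poly_vector (block k)"
  by (simp add: poly_vector_def block_def poly_functions.var)

lemma poly_vector_const: "poly_vector (\<lambda>e. c)"
  by (simp add: poly_vector_def poly_functions.const)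

lemma poly_vector_add: "poly_vector u \<Longrightarrow> poly_vector v \<Longrightarrow> poly_vector (\<lambda>e. u e + v e)"
  by (simp add: poly_vector_def poly_functions.add)

lemma poly_vector_diff: "poly_vector u \<Longrightarrow> poly_vector v \<Longrightarrow> poly_vector (\<lambda>e. u e - v e)"
  by (simp add: poly_vector_def poly_functions_diff)

lemma poly_functions_inner:
  fixes u v :: "'n::finite env \<Rightarrow> real ^ 'n"
  shows "poly_vector u \<Longrightarrow> poly_vector v \<Longrightarrow> (\<lambda>e. u e \<bullet> v e) \<in> poly_functions"
  unfolding inner_vec_def inner_real_def
  by (intro poly_functions_sum poly_functions.mult) (auto simp: poly_vector_def)

lemma poly_functions_eval_rpoly:
  fixes u :: "'n::finite env \<Rightarrow> real ^ 'n"
  assumes "poly_vector u"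
  shows "(\<lambda>e. eval_rpoly f (u e)) \<in> poly_functions"
  unfolding eval_rpoly_def
  by (intro poly_functions_sum poly_functions.mult poly_functions.const poly_functions_prod
      poly_functions_power) (use assms in \<open>simp add: poly_vector_def\<close>)

lemma poly_vector_polymap:
  fixes u :: "'n::finite env \<Rightarrow> real ^ 'n"
  assumes "poly_vector u"
  shows "poly_vector (\<lambda>e. polymap P (u e))"
  unfolding poly_vector_def polymap_def using poly_functions_eval_rpoly[OF assms] by simp

lemma definable_mem_semialgebraic:
  fixes K :: "(real ^ 'n::finite) set"
  assumes "semialgebraic K" "poly_vector u"
  shows "definable (\<lambda>e. u e \<in> K)"
proof -
  obtain \<C> :: "('n rpoly set \<times> 'n rpoly set) set" where C: "finite \<C>"
    "\<And>E G. (E, G) \<in> \<C> \<Longrightarrow> finite E \<and> finite G"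
    "K = (\<Union>(E, G)\<in>\<C>. {x. (\<forall>f\<in>E. eval_rpoly f x = 0) \<and> (\<forall>g\<in>G. eval_rpoly g x > 0)})"
    using assms(1) unfolding semialgebraic_def by (fastforce simp: split_beta)
  define F where "F = (\<lambda>f e. eval_rpoly f (u e)) ` (\<Union>(E, G)\<in>\<C>. E \<union> G)"
  have "finite F" unfolding F_def using C(1,2) by (intro finite_imageI finite_UN_I) (auto split: prod.split)
  moreover have "F \<subseteq> poly_functions"
    using poly_functions_eval_rpoly[OF assms(2)] by (auto simp: F_def)
  moreover have "u e \<in> K" if ss: "same_signs F e e'" and uK: "u e' \<in> K" for e e'
  proof -
    obtain E G where EG: "(E, G) \<in> \<C>" "\<forall>f\<in>E. eval_rpoly f (u e') = 0" "\<forall>g\<in>G. eval_rpoly g (u e') > 0"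
      using uK C(3) by auto
    have sg: "sgn (eval_rpoly f (u e)) = sgn (eval_rpoly f (u e'))" if "f \<in> E \<union> G" for f
    proof -
      have "(\<lambda>e. eval_rpoly f (u e)) \<in> F" using EG(1) that unfolding F_def by fast
      with ss show ?thesis unfolding same_signs_def by (rule bspec)
    qed
    have "\<forall>f\<in>E. eval_rpoly f (u e) = 0" using sg EG(2) by (metis UnI1 sgn_zero_iff)
    moreover have "\<forall>g\<in>G. eval_rpoly g (u e) > 0" using sg EG(3) by (metis UnI2 sgn_greater)
    ultimately show ?thesis using EG(1) C(3) by auto
  qed
  then have "\<forall>e e'. same_signs F e e' \<longrightarrow> (u e \<in> K) = (u e' \<in> K)"
    by (simp add: same_signs_def) metis
  ultimately show ?thesis unfolding pf.sign_determined_def by blast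
qed

section \<open>Semialgebraic relations between two small positive numbers\<close>

text \<open>
  Near zero a polynomial behaves like its lowest term. This is the source of the Hoelder exponent.
\<close>
lemma poly_near_zero_from_right:
  fixes q :: "real poly"
  assumes "q \<noteq> 0"
  shows "\<exists>\<sigma> c N \<epsilon>. c > 0 \<and> \<epsilon> > 0 \<and>
    (\<forall>s. 0 < s \<and> s < \<epsilon> \<longrightarrow> c * s ^ N \<le> \<bar>poly q s\<bar> \<and> sgn (poly q s) = \<sigma>)"
  using assms
proof (induction q)
  case 0
  then show ?case by simp
next
  case (pCons a q)
  show ?case
  proof (cases "a = 0")
    case True
    then have "q \<noteq> 0" using pCons.hyps by simp
    from pCons.IH[OF this] obtain \<sigma> c N \<epsilon> where c: "c > 0" "\<epsilon> > 0"
      "\<forall>s. 0 < s \<and> s < \<epsilon> \<longrightarrow> c * s ^ N \<le> \<bar>poly q s\<bar> \<and> sgn (poly q s) = \<sigma>"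
      by (elim exE conjE)
    then have IH: "c * s ^ N \<le> \<bar>poly q s\<bar> \<and> sgn (poly q s) = \<sigma>" if "0 < s" "s < \<epsilon>" for s
      using that by simp
    have "\<forall>s. 0 < s \<and> s < \<epsilon> \<longrightarrow>
        c * s ^ Suc N \<le> \<bar>poly (pCons a q) s\<bar> \<and> sgn (poly (pCons a q) s) = \<sigma>"
    proof (intro allI impI, elim conjE)
      fix s assume that: "0 < s" "s < \<epsilon>"
      have "s * (c * s ^ N) \<le> s * \<bar>poly q s\<bar>" using IH[OF that] that by (intro mult_left_mono) auto
      then show "c * s ^ Suc N \<le> \<bar>poly (pCons a q) s\<bar> \<and> sgn (poly (pCons a q) s) = \<sigma>"
        using IH[OF that] that True by (simp add: sgn_mult abs_mult ac_simps)
    qed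
    with c(1,2) show ?thesis
      by (intro exI[of _ \<sigma>] exI[of _ c] exI[of _ "Suc N"] exI[of _ \<epsilon>] conjI)
  next
    case False
    let ?q = "pCons a q"
    have "isCont (poly ?q) 0" by simp
    then obtain \<delta> where \<delta>: "\<delta> > 0" "\<And>s. \<bar>s\<bar> < \<delta> \<Longrightarrow> \<bar>poly ?q s - a\<bar> < \<bar>a\<bar> / 2"
      using False unfolding continuous_at_eps_delta dist_real_def
      by (metis diff_zero half_gt_zero mult_zero_left poly_pCons add.right_neutral zero_less_abs_iff)
    have "\<forall>s. 0 < s \<and> s < \<delta> \<longrightarrow> \<bar>a\<bar> / 2 * s ^ 0 \<le> \<bar>poly ?q s\<bar> \<and> sgn (poly ?q s) = sgn a"
    proof (intro allI impI, elim conjE)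
      fix s assume that: "0 < s" "s < \<delta>"
      have "\<bar>poly ?q s - a\<bar> < \<bar>a\<bar> / 2" using \<delta>(2)[of s] that by simp
      then show "\<bar>a\<bar> / 2 * s ^ 0 \<le> \<bar>poly ?q s\<bar> \<and> sgn (poly ?q s) = sgn a"
        by (auto simp: sgn_if abs_if split: if_splits)
    qed
    moreover have "\<bar>a\<bar> / 2 > 0" using False by simp
    ultimately show ?thesis using \<delta>(1)
      by (intro exI[of _ "sgn a"] exI[of _ "\<bar>a\<bar> / 2"] exI[of _ 0] exI[of _ \<delta>] conjI)
  qed
qed

lemma bipoly_bounded_on_unit_square:
  fixes P :: "real poly poly"
  shows "\<exists>M. \<forall>s t. 0 < s \<and> s < 1 \<and> 0 < t \<and> t < 1 \<longrightarrow> \<bar>poly (poly P [:t:]) s\<bar> \<le> M"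
proof (induction P)
  case 0
  then show ?case by (intro exI[of _ 0]) simp
next
  case (pCons a P)
  from pCons.IH obtain M where
    M: "\<And>s t. 0 < s \<Longrightarrow> s < 1 \<Longrightarrow> 0 < t \<Longrightarrow> t < 1 \<Longrightarrow> \<bar>poly (poly P [:t:]) s\<bar> \<le> M" by blast
  have "bounded (poly a ` {0..1})"
    by (intro compact_imp_bounded compact_continuous_image continuous_intros compact_Icc)
  then obtain B where B: "\<forall>s\<in>{0..1}. \<bar>poly a s\<bar> \<le> B"
    unfolding bounded_iff by auto
  have "\<bar>poly (poly (pCons a P) [:t:]) s\<bar> \<le> B + M" if "0 < s" "s < 1" "0 < t" "t < 1" for s t
  proof -
    have "\<bar>t * poly (poly P [:t:]) s\<bar> \<le> 1 * M"
      unfolding abs_mult using M[OF that] that by (intro mult_mono) auto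
    moreover have "\<bar>poly a s\<bar> \<le> B" using B that by simp
    ultimately show ?thesis by simp
  qed
  then show ?case by blast
qed

text \<open>
  The region under the graph of \<open>s\<^sup>N\<close> close to the origin. These regions shrink
  as \<open>N\<close> grows, so "for all large \<open>N\<close>" can be combined for finitely many
  polynomials, and one parameter covers exponent, factor and size of the neighbourhood.
\<close>
definition corner :: "nat \<Rightarrow> (real \<times> real) set" where
  "corner N = {(s, t). 0 < s \<and> s < 1 / real N \<and> 0 < t \<and> t < s ^ N}"

text \<open>
  The polynomial \<open>P\<close> in \<open>t\<close> has coefficients that are polynomials in
  \<open>s\<close>. If \<open>a\<close> is its lowest nonzero coefficient, then
  \<open>\<bar>a(s)\<bar>\<close> is at least a multiple of a power of \<open>s\<close>, and for
  \<open>t\<close> smaller than a higher power of \<open>s\<close> the remaining terms cannot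
  outweigh it.
\<close>
lemma sgn_bipoly_constant_on_corner:
  fixes P :: "real poly poly"
  shows "\<exists>\<sigma>. \<forall>\<^sub>F N in sequentially. \<forall>(s, t)\<in>corner N. sgn (poly (poly P [:t:]) s) = \<sigma>"
proof (induction P)
  case 0
  then show ?case by (intro exI[of _ 0]) simp
next
  case (pCons a P)
  show ?case
  proof (cases "a = 0")
    case True
    from pCons.IH obtain \<sigma> where
      "\<forall>\<^sub>F N in sequentially. \<forall>(s, t)\<in>corner N. sgn (poly (poly P [:t:]) s) = \<sigma>" by blast
    then have "\<forall>\<^sub>F N in sequentially. \<forall>(s, t)\<in>corner N. sgn (poly (poly (pCons a P) [:t:]) s) = \<sigma>"
      by eventually_elim (use True in \<open>auto simp: corner_def sgn_mult\<close>)
    then show ?thesis by blast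
  next
    case False
    from poly_near_zero_from_right[OF False] obtain \<sigma> c N \<epsilon> where c: "c > 0" "\<epsilon> > 0"
      "\<forall>s. 0 < s \<and> s < \<epsilon> \<longrightarrow> c * s ^ N \<le> \<bar>poly a s\<bar> \<and> sgn (poly a s) = \<sigma>"
      by (elim exE conjE)
    then have a: "c * s ^ N \<le> \<bar>poly a s\<bar> \<and> sgn (poly a s) = \<sigma>" if "0 < s" "s < \<epsilon>" for s
      using that by simp
    from bipoly_bounded_on_unit_square[of P] obtain M where
      M: "\<And>s t. 0 < s \<Longrightarrow> s < 1 \<Longrightarrow> 0 < t \<Longrightarrow> t < 1 \<Longrightarrow> \<bar>poly (poly P [:t:]) s\<bar> \<le> M" by blast
    define M' where "M' = max M 1"
    have M': "M' > 0" "M \<le> M'" by (auto simp: M'_def)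
    \<comment> \<open>These make s smaller than epsilon and than c / M', so that the extra factor s beats the constant.\<close>
    have "\<forall>\<^sub>F n in sequentially. real n > 1 / \<epsilon> \<and> real n > M' / c \<and> n \<ge> Suc N"
      by (intro eventually_conj eventually_ge_at_top filterlim_at_top_dense[THEN iffD1, rule_format]
          filterlim_real_sequentially)
    then have "\<forall>\<^sub>F n in sequentially. \<forall>(s, t)\<in>corner n. sgn (poly (poly (pCons a P) [:t:]) s) = \<sigma>"
    proof eventually_elim
      case (elim n)
      have "sgn (poly a s + t * poly (poly P [:t:]) s) = \<sigma>"
        if st: "0 < s" "s < 1 / real n" "0 < t" "t < s ^ n" for s t
      proof -
        have n: "real n \<ge> 1" using elim by simp
        have "s * real n < 1" using st(2) n by (simp add: field_simps)
        moreover have "s * 1 \<le> s * real n" using st(1) n by (intro mult_left_mono) auto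
        ultimately have "s < 1" by simp
        have "1 / real n < \<epsilon>" using elim c(2) n by (simp add: field_simps)
        then have "s < \<epsilon>" using st(2) by simp
        have "1 / real n < c / M'" using elim c(1) n M' by (simp add: field_simps)
        then have "s < c / M'" using st(2) by simp
        then have sc: "M' * s < c" using M' by (simp add: field_simps)
        have "s ^ n \<le> s ^ Suc N" using elim st(1) \<open>s < 1\<close> by (intro power_decreasing) auto
        then have t: "t < s * s ^ N" using st(4) by simp
        also have "\<dots> \<le> 1 * 1" using st(1) \<open>s < 1\<close> by (intro mult_mono power_le_one) auto
        finally have "t < 1" by simp
        have "\<bar>t * poly (poly P [:t:]) s\<bar> \<le> t * M'"
          unfolding abs_mult using M[OF st(1) \<open>s < 1\<close> st(3) \<open>t < 1\<close>] M' st(3) by (intro mult_mono) auto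
        also have "\<dots> < (s * s ^ N) * M'" using t M' by simp
        also have "\<dots> = (M' * s) * s ^ N" by simp
        also have "\<dots> < c * s ^ N" using sc st(1) by simp
        also have "\<dots> \<le> \<bar>poly a s\<bar>" using a[OF st(1) \<open>s < \<epsilon>\<close>] by simp
        finally have "sgn (poly a s + t * poly (poly P [:t:]) s) = sgn (poly a s)"
          by (auto simp: sgn_if abs_if split: if_splits)
        then show ?thesis using a[OF st(1) \<open>s < \<epsilon>\<close>] by simp
      qed
      then show ?case by (auto simp: corner_def)
    qed
    then show ?thesis by blast
  qed
qed

lemma poly_function_in_two_variables:
  assumes "f \<in> poly_functions" "a \<noteq> b"
  shows "\<exists>P. \<forall>s t. f (e(a := s, b := t)) = poly (poly P [:t:]) s"
  using assms(1)
proof induction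
  case (const c)
  show ?case by (intro exI[of _ "[:[:c:]:]"]) simp
next
  case (var v)
  consider "v = a" | "v = b" | "v \<noteq> a" "v \<noteq> b" by blast
  then show ?case
  proof cases
    case 1
    then show ?thesis using assms(2) by (intro exI[of _ "[:[:0, 1:]:]"]) simp
  next
    case 2
    then show ?thesis by (intro exI[of _ "[:0, 1:]"]) simp
  next
    case 3
    then show ?thesis by (intro exI[of _ "[:[:e v:]:]"]) simp
  qed
next
  case (add f g)
  from add.IH obtain P Q where "\<forall>s t. f (e(a := s, b := t)) = poly (poly P [:t:]) s"
    "\<forall>s t. g (e(a := s, b := t)) = poly (poly Q [:t:]) s" by (elim exE)
  note PQ = this
  show ?case by (intro exI[of _ "P + Q"] allI) (simp only: PQ poly_add)
next
  case (mult f g)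
  from mult.IH obtain P Q where "\<forall>s t. f (e(a := s, b := t)) = poly (poly P [:t:]) s"
    "\<forall>s t. g (e(a := s, b := t)) = poly (poly Q [:t:]) s" by (elim exE)
  note PQ = this
  show ?case by (intro exI[of _ "P * Q"] allI) (simp only: PQ poly_mult)
qed

text \<open>
  This replaces the Lojasiewicz inequality: a semialgebraic relation between two small positive
  numbers \<open>s\<close> and \<open>t\<close> cannot change its truth value as long as
  \<open>t\<close> stays below a fixed power of \<open>s\<close>.
\<close>
theorem definable_constant_on_corner:
  assumes "definable \<phi>" "a \<noteq> b"
  shows "\<exists>N>0. \<forall>(s, t)\<in>corner N. \<forall>(s', t')\<in>corner N.
    \<phi> (e(a := s, b := t)) = \<phi> (e(a := s', b := t'))"
proof -
  from assms(1) obtain F where F: "finite F" "F \<subseteq> poly_functions"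
    "\<And>e e'. same_signs F e e' \<Longrightarrow> \<phi> e = \<phi> e'" unfolding pf.sign_determined_def by metis
  have "\<exists>\<sigma>. \<forall>\<^sub>F N in sequentially. \<forall>(s, t)\<in>corner N. sgn (f (e(a := s, b := t))) = \<sigma>" if "f \<in> F" for f
  proof -
    from poly_function_in_two_variables[OF subsetD[OF F(2) that] assms(2), of e]
    obtain P where P: "\<forall>s t. f (e(a := s, b := t)) = poly (poly P [:t:]) s" by (elim exE)
    show ?thesis unfolding P[rule_format] by (rule sgn_bipoly_constant_on_corner)
  qed
  then have "\<forall>f\<in>F. \<exists>\<sigma>. \<forall>\<^sub>F N in sequentially. \<forall>(s, t)\<in>corner N. sgn (f (e(a := s, b := t))) = \<sigma>"
    by (rule ballI)
  from bchoice[OF this] obtain \<sigma> where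
    "\<forall>f\<in>F. \<forall>\<^sub>F N in sequentially. \<forall>(s, t)\<in>corner N. sgn (f (e(a := s, b := t))) = \<sigma> f" by (rule exE)
  then have "\<forall>\<^sub>F N in sequentially. \<forall>f\<in>F. \<forall>(s, t)\<in>corner N. sgn (f (e(a := s, b := t))) = \<sigma> f"
    by (rule eventually_ball_finite[OF F(1)])
  then have "\<forall>\<^sub>F N in sequentially. N > 0 \<and>
      (\<forall>f\<in>F. \<forall>(s, t)\<in>corner N. sgn (f (e(a := s, b := t))) = \<sigma> f)"
    by (intro eventually_conj eventually_gt_at_top)
  from eventually_happens'[OF sequentially_bot this] obtain N where N: "N > 0"
    "\<forall>f\<in>F. \<forall>(s, t)\<in>corner N. sgn (f (e(a := s, b := t))) = \<sigma> f"
    by (elim exE conjE)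
  have "\<phi> (e(a := s, b := t)) = \<phi> (e(a := s', b := t'))"
    if "(s, t) \<in> corner N" "(s', t') \<in> corner N" for s t s' t'
  proof (rule F(3), unfold same_signs_def, rule ballI)
    fix f assume "f \<in> F"
    from bspec[OF bspec[OF N(2) this] that(1)] bspec[OF bspec[OF N(2) \<open>f \<in> F\<close>] that(2)]
    show "sgn (f (e(a := s, b := t))) = sgn (f (e(a := s', b := t')))" by simp
  qed
  then show ?thesis using N(1) by (intro exI[of _ N] conjI ballI) (simp_all add: split_beta)
qed

section \<open>Behaviour of the variational inequality at infinity\<close>

lemma lookup_hom_component:
  "Poly_Mapping.lookup (hom_component d f) m =
    (if monom_degree m = d then Poly_Mapping.lookup f m else 0)"
proof -
  have "Poly_Mapping.lookup (hom_component d f) m =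
      (\<Sum>m'\<in>{m \<in> Poly_Mapping.keys f. monom_degree m = d}. if m' = m then Poly_Mapping.lookup f m' else 0)"
    unfolding hom_component_def lookup_sum by (intro sum.cong) (auto simp: lookup_single when_def)
  also have "\<dots> = (if monom_degree m = d then Poly_Mapping.lookup f m else 0)"
    by (auto simp: sum.delta in_keys_iff)
  finally show ?thesis .
qed

lemma eval_rpoly_superset:
  assumes "finite S" "Poly_Mapping.keys f \<subseteq> S"
  shows "eval_rpoly f x = (\<Sum>m\<in>S. Poly_Mapping.lookup f m * (\<Prod>i\<in>UNIV. (x $ i) ^ Poly_Mapping.lookup m i))"
  unfolding eval_rpoly_def using assms by (intro sum.mono_neutral_left) (auto simp: in_keys_iff)

lemma eval_hom_component:
  "eval_rpoly (hom_component d f) v =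
    (\<Sum>m\<in>Poly_Mapping.keys f. (if monom_degree m = d then Poly_Mapping.lookup f m else 0) *
      (\<Prod>i\<in>UNIV. (v $ i) ^ Poly_Mapping.lookup m i))"
proof -
  have "Poly_Mapping.keys (hom_component d f) \<subseteq> Poly_Mapping.keys f"
    by (auto simp: in_keys_iff lookup_hom_component split: if_splits)
  from eval_rpoly_superset[OF finite_keys this, of v] show ?thesis by (simp add: lookup_hom_component)
qed

text \<open>
  Dividing by the norm to the power \<open>d\<close> gives one factor to each occurrence of a
  variable in the monomial; the \<open>d - monom_degree m\<close> factors left over send the
  monomials of smaller degree to zero.
\<close>
lemma monomial_scaled_limit:
  fixes x :: "nat \<Rightarrow> real ^ 'n::finite"
  assumes inf: "filterlim (\<lambda>k. norm (x k)) at_top sequentially"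
    and dir: "(\<lambda>k. x k /\<^sub>R norm (x k)) \<longlonglongrightarrow> v"
    and deg: "monom_degree m \<le> d"
  shows "(\<lambda>k. (\<Prod>i\<in>UNIV. (x k $ i) ^ Poly_Mapping.lookup m i) / norm (x k) ^ d) \<longlonglongrightarrow>
    (if monom_degree m = d then \<Prod>i\<in>UNIV. (v $ i) ^ Poly_Mapping.lookup m i else 0)"
proof -
  have inv: "(\<lambda>k. inverse (norm (x k))) \<longlonglongrightarrow> 0"
    using inf by (rule tendsto_inverse_0_at_top)
  have "(\<lambda>k. inverse (norm (x k)) ^ (d - monom_degree m)) \<longlonglongrightarrow> 0 ^ (d - monom_degree m)"
    by (intro tendsto_power inv)
  moreover have "(0 :: real) ^ (d - monom_degree m) = (if monom_degree m = d then 1 else 0)"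
    using deg by auto
  ultimately have 1: "(\<lambda>k. inverse (norm (x k)) ^ (d - monom_degree m)) \<longlonglongrightarrow>
      (if monom_degree m = d then 1 else 0)" by simp
  have 2: "(\<lambda>k. \<Prod>i\<in>UNIV. ((x k /\<^sub>R norm (x k)) $ i) ^ Poly_Mapping.lookup m i) \<longlonglongrightarrow>
      (\<Prod>i\<in>UNIV. (v $ i) ^ Poly_Mapping.lookup m i)"
    by (intro tendsto_prod tendsto_power tendsto_vec_nth dir)
  have "\<forall>\<^sub>F k in sequentially. norm (x k) > 0"
    using inf unfolding filterlim_at_top_dense by blast
  then have "\<forall>\<^sub>F k in sequentially.
      inverse (norm (x k)) ^ (d - monom_degree m) *
        (\<Prod>i\<in>UNIV. ((x k /\<^sub>R norm (x k)) $ i) ^ Poly_Mapping.lookup m i) =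
      (\<Prod>i\<in>UNIV. (x k $ i) ^ Poly_Mapping.lookup m i) / norm (x k) ^ d"
  proof eventually_elim
    case (elim k)
    let ?r = "norm (x k)"
    have "(\<Prod>i\<in>UNIV. ((x k /\<^sub>R ?r) $ i) ^ Poly_Mapping.lookup m i) =
        inverse ?r ^ monom_degree m * (\<Prod>i\<in>UNIV. (x k $ i) ^ Poly_Mapping.lookup m i)"
      by (simp add: power_mult_distrib prod.distrib monom_degree_def power_sum)
    moreover have "inverse ?r ^ (d - monom_degree m) * inverse ?r ^ monom_degree m = inverse ?r ^ d"
      using deg by (simp flip: power_add)
    ultimately show ?case by (simp add: field_simps power_inverse)
  qed
  from Lim_transform_eventually[OF tendsto_mult[OF 1 2] this] show ?thesis
    by (cases "monom_degree m = d") simp_all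
qed

lemma monom_degree_le_polymap_degree:
  assumes "m \<in> Poly_Mapping.keys (P $ l)"
  shows "monom_degree m \<le> polymap_degree P"
proof -
  have "monom_degree m \<le> rpoly_degree (P $ l)"
    unfolding rpoly_degree_def using assms by (intro Max_ge) auto
  also have "\<dots> \<le> polymap_degree P"
    unfolding polymap_degree_def by (intro Max_ge) auto
  finally show ?thesis .
qed

lemma polymap_scaled_limit:
  fixes x :: "nat \<Rightarrow> real ^ 'n::finite"
  assumes "filterlim (\<lambda>k. norm (x k)) at_top sequentially"
    and "(\<lambda>k. x k /\<^sub>R norm (x k)) \<longlonglongrightarrow> v"
  shows "(\<lambda>k. polymap P (x k) /\<^sub>R norm (x k) ^ polymap_degree P) \<longlonglongrightarrow> polymap (leading_part P) v"
proof (rule vec_tendstoI)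
  fix l
  let ?d = "polymap_degree P"
  have "(\<lambda>k. \<Sum>m\<in>Poly_Mapping.keys (P $ l). Poly_Mapping.lookup (P $ l) m *
      ((\<Prod>i\<in>UNIV. (x k $ i) ^ Poly_Mapping.lookup m i) / norm (x k) ^ ?d)) \<longlonglongrightarrow>
    (\<Sum>m\<in>Poly_Mapping.keys (P $ l). Poly_Mapping.lookup (P $ l) m *
      (if monom_degree m = ?d then \<Prod>i\<in>UNIV. (v $ i) ^ Poly_Mapping.lookup m i else 0))"
    by (intro tendsto_sum tendsto_mult tendsto_const monomial_scaled_limit assms
        monom_degree_le_polymap_degree)
  moreover have "(\<Sum>m\<in>Poly_Mapping.keys (P $ l). Poly_Mapping.lookup (P $ l) m *
      (if monom_degree m = ?d then \<Prod>i\<in>UNIV. (v $ i) ^ Poly_Mapping.lookup m i else 0)) =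
      polymap (leading_part P) v $ l"
    unfolding polymap_def leading_part_def by (simp add: eval_hom_component) (intro sum.cong, auto)
  moreover have "(\<Sum>m\<in>Poly_Mapping.keys (P $ l). Poly_Mapping.lookup (P $ l) m *
      ((\<Prod>i\<in>UNIV. (x k $ i) ^ Poly_Mapping.lookup m i) / norm (x k) ^ ?d)) =
      (polymap P (x k) /\<^sub>R norm (x k) ^ ?d) $ l" for k
    by (simp add: polymap_def eval_rpoly_def sum_distrib_left field_simps)
  ultimately show "(\<lambda>k. (polymap P (x k) /\<^sub>R norm (x k) ^ ?d) $ l) \<longlonglongrightarrow> polymap (leading_part P) v $ l"
    by simp
qed

lemma tendsto_polymap:
  fixes x :: "nat \<Rightarrow> real ^ 'n::finite"
  assumes "x \<longlonglongrightarrow> v"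
  shows "(\<lambda>k. polymap P (x k)) \<longlonglongrightarrow> polymap P v"
  unfolding polymap_def eval_rpoly_def
  by (intro tendsto_vec_lambda tendsto_sum tendsto_mult tendsto_const tendsto_prod tendsto_power
      tendsto_vec_nth assms)

text \<open>
  Since \<open>0 \<in> K\<close>, the points \<open>c x\<^sub>k / t\<^sub>k\<close> lie on
  segments from \<open>0\<close> to \<open>x\<^sub>k\<close> as soon as \<open>t\<^sub>k \<ge>
  c\<close>.
\<close>
lemma asymptotic_cone_scale_mem:
  fixes K :: "(real ^ 'n::finite) set"
  assumes "closed K" "convex K" "0 \<in> K" "w \<in> asymptotic_cone K" "c \<ge> 0"
  shows "c *\<^sub>R w \<in> K"
proof -
  obtain t x where tx: "filterlim t at_top sequentially" "\<And>k. x k \<in> K" "(\<lambda>k. x k /\<^sub>R t k) \<longlonglongrightarrow> w"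
    using assms(4) by (auto simp: asymptotic_cone_def)
  have "\<forall>\<^sub>F k in sequentially. t k > 0 \<and> t k > c"
    using tx(1) unfolding filterlim_at_top_dense by (intro eventually_conj) blast+
  then have "\<forall>\<^sub>F k in sequentially. c *\<^sub>R (x k /\<^sub>R t k) \<in> K"
  proof eventually_elim
    case (elim k)
    have "(1 - c / t k) *\<^sub>R 0 + (c / t k) *\<^sub>R x k \<in> K"
      using elim assms(5) by (intro convexD[OF assms(2)] assms(3) tx(2)) (auto simp: field_simps)
    then show ?case by (simp add: divide_inverse)
  qed
  then show ?thesis
    by (rule Lim_in_closed_set[OF assms(1) _ sequentially_bot]) (intro tendsto_scaleR tendsto_const tx(3))
qed

lemma SOL_limit:
  fixes K :: "(real ^ 'n::finite) set"
  assumes "closed K" "x \<longlonglongrightarrow> v" "q \<longlonglongrightarrow> p" "\<And>k. x k \<in> SOL K (\<lambda>x. polymap P x + q k)"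
  shows "v \<in> SOL K (\<lambda>x. polymap P x + p)"
proof -
  have "v \<in> K" by (rule closed_sequentially[OF assms(1) _ assms(2)]) (use assms(4) in \<open>auto simp: SOL_def\<close>)
  moreover have "(polymap P v + p) \<bullet> (y - v) \<ge> 0" if "y \<in> K" for y
  proof (rule tendsto_lowerbound)
    show "(\<lambda>k. (polymap P (x k) + q k) \<bullet> (y - x k)) \<longlonglongrightarrow> (polymap P v + p) \<bullet> (y - v)"
      by (intro tendsto_inner tendsto_add tendsto_diff tendsto_const tendsto_polymap assms(2,3))
    show "\<forall>\<^sub>F k in sequentially. (polymap P (x k) + q k) \<bullet> (y - x k) \<ge> 0"
      using assms(4) that by (auto simp: SOL_def)
  qed simp
  ultimately show ?thesis by (simp add: SOL_def)
qed

lemma inner_pos_of_interior_dual_cone: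
  fixes p :: "real ^ 'n::finite"
  assumes "p \<in> interior (dual_cone C)" "v \<in> C" "v \<noteq> 0"
  shows "p \<bullet> v > 0"
proof -
  obtain r where r: "r > 0" "ball p r \<subseteq> dual_cone C"
    using assms(1) by (auto simp: mem_interior)
  \<comment> \<open>A point of the ball around p, moved against v as far as half the radius.\<close>
  let ?q = "p - (r / (2 * norm v)) *\<^sub>R v"
  have "dist p ?q = r / 2" using assms(3) r(1) by (simp add: dist_norm)
  then have "?q \<in> ball p r" using r(1) by simp
  with r(2) have "?q \<in> dual_cone C" by (rule subsetD)
  then have "?q \<bullet> v \<ge> 0" using assms(2) unfolding dual_cone_def by blast
  then have "p \<bullet> v \<ge> (r / (2 * norm v)) * (v \<bullet> v)" by (simp add: inner_diff_left)
  moreover have "(r / (2 * norm v)) * (v \<bullet> v) > 0" using r(1) assms(3) by simp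
  ultimately show ?thesis by linarith
qed

text \<open>
  Otherwise there are solutions \<open>y\<^sub>k\<close> for parameters \<open>s\<^sub>k\<close>
  tending to \<open>p\<close> whose norms tend to infinity and whose directions converge to a unit
  vector \<open>v\<close>. Testing with \<open>norm (y\<^sub>k) w \<in> K\<close> for
  \<open>w\<close> in the asymptotic cone and dividing by \<open>norm (y\<^sub>k)\<close> to the
  power \<open>d + 1\<close> shows that \<open>v\<close> solves the problem at infinity, so
  \<open>p \<bullet> v > 0\<close>. Testing with \<open>0 \<in> K\<close> and using copositivity
  gives \<open>s\<^sub>k \<bullet> y\<^sub>k \<le> 0\<close>, hence \<open>p \<bullet> v \<le>
  0\<close>.
\<close>
lemma SOL_locally_bounded:
  fixes K :: "(real ^ 'n::finite) set" and P :: "'n rpoly ^ 'n"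
  assumes K: "closed K" "convex K" "0 \<in> K" and d: "polymap_degree P > 0"
    and cop: "copositive_on K (polymap P)"
    and p: "p \<in> interior (dual_cone (SOL (asymptotic_cone K) (polymap (leading_part P))))"
  shows "\<exists>r>0. \<exists>R. \<forall>q\<in>ball p r. \<forall>x\<in>SOL K (\<lambda>x. polymap P x + q). norm x \<le> R"
proof (rule ccontr)
  assume contra: "\<not> ?thesis"
  have "\<exists>q x. dist p q < 1 / real (Suc k) \<and> x \<in> SOL K (\<lambda>x. polymap P x + q) \<and> norm x > real (Suc k)" for k
  proof -
    have "\<not> (\<forall>q\<in>ball p (1 / real (Suc k)). \<forall>x\<in>SOL K (\<lambda>x. polymap P x + q). norm x \<le> real (Suc k))"
      using contra by (metis of_nat_0_less_iff zero_less_Suc zero_less_divide_1_iff)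
    then show ?thesis by (auto simp: not_le)
  qed
  then obtain q x where qx: "\<And>k. dist p (q k) < 1 / real (Suc k)"
    "\<And>k. x k \<in> SOL K (\<lambda>x. polymap P x + q k)" "\<And>k. norm (x k) > real (Suc k)" by metis
  have nz: "norm (x k) > 0" for k using qx(3)[of k] by (meson of_nat_0_le_iff order_le_less_trans)
  have "\<forall>k. x k /\<^sub>R norm (x k) \<in> sphere 0 1" using nz by simp
  then obtain v r where vr: "v \<in> sphere 0 1" "strict_mono r"
    "((\<lambda>k. x k /\<^sub>R norm (x k)) \<circ> r) \<longlonglongrightarrow> v"
    using compact_sphere[of "0 :: real ^ 'n" 1] unfolding compact_def by meson
  define y where "y = x \<circ> r"
  define s where "s = q \<circ> r"
  have inf: "filterlim (\<lambda>k. norm (y k)) at_top sequentially"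
  proof (rule filterlim_at_top_mono[OF filterlim_real_sequentially])
    show "\<forall>\<^sub>F k in sequentially. real k \<le> norm (y k)"
    proof (rule always_eventually, rule allI)
      fix k
      have "real k \<le> real (Suc (r k))" using seq_suble[OF vr(2), of k] by simp
      with qx(3)[of "r k"] show "real k \<le> norm (y k)" by (simp add: y_def)
    qed
  qed
  have dir: "(\<lambda>k. y k /\<^sub>R norm (y k)) \<longlonglongrightarrow> v" using vr(3) by (simp add: y_def o_def)
  have "q \<longlonglongrightarrow> p"
  proof (rule metric_LIMSEQ_I)
    fix e :: real assume "e > 0"
    then obtain N where N: "1 / real (Suc N) < e" by (rule nat_approx_posE)
    have "dist (q k) p < e" if "k \<ge> N" for k
    proof -
      have "1 / real (Suc k) \<le> 1 / real (Suc N)" using that by (simp add: frac_le)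
      with N qx(1)[of k] show ?thesis by (simp add: dist_commute)
    qed
    then show "\<exists>N. \<forall>k\<ge>N. dist (q k) p < e" by blast
  qed
  then have s: "s \<longlonglongrightarrow> p" unfolding s_def by (rule LIMSEQ_subseq_LIMSEQ[OF _ vr(2)])
  have y: "y k \<in> K" "\<And>z. z \<in> K \<Longrightarrow> (polymap P (y k) + s k) \<bullet> (z - y k) \<ge> 0" for k
    using qx(2)[of "r k"] by (auto simp: y_def s_def SOL_def)
  have ynz: "norm (y k) > 0" for k using nz by (simp add: y_def)
  let ?d = "polymap_degree P" and ?L = "polymap (leading_part P)"
  have v: "v \<in> asymptotic_cone K"
    unfolding asymptotic_cone_def using inf dir y(1) by blast
  have inv0: "(\<lambda>k. inverse (norm (y k)) ^ ?d) \<longlonglongrightarrow> 0"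
    using tendsto_inverse_0_at_top[OF inf] d by simp
  have lead: "(\<lambda>k. polymap P (y k) /\<^sub>R norm (y k) ^ ?d) \<longlonglongrightarrow> ?L v"
    by (rule polymap_scaled_limit[OF inf dir])
  have main: "(\<lambda>k. (polymap P (y k) /\<^sub>R norm (y k) ^ ?d + (inverse (norm (y k)) ^ ?d) *\<^sub>R s k) \<bullet>
      (w - y k /\<^sub>R norm (y k))) \<longlonglongrightarrow> (?L v + 0 *\<^sub>R p) \<bullet> (w - v)" for w
    by (intro tendsto_intros lead inv0 s dir)
  have pos: "?L v \<bullet> (w - v) \<ge> 0" if w: "w \<in> asymptotic_cone K" for w
  proof -
    have "(polymap P (y k) /\<^sub>R norm (y k) ^ ?d + (inverse (norm (y k)) ^ ?d) *\<^sub>R s k) \<bullet>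
      (w - y k /\<^sub>R norm (y k)) \<ge> 0" for k
    proof -
      have "norm (y k) *\<^sub>R w \<in> K" by (rule asymptotic_cone_scale_mem[OF K w]) simp
      then have "(polymap P (y k) + s k) \<bullet> (norm (y k) *\<^sub>R w - y k) \<ge> 0" by (rule y(2))
      then have "inverse (norm (y k)) ^ ?d * inverse (norm (y k)) *
          ((polymap P (y k) + s k) \<bullet> (norm (y k) *\<^sub>R w - y k)) \<ge> 0" by simp
      also have "inverse (norm (y k)) ^ ?d * inverse (norm (y k)) *
          ((polymap P (y k) + s k) \<bullet> (norm (y k) *\<^sub>R w - y k)) =
        (inverse (norm (y k)) ^ ?d *\<^sub>R (polymap P (y k) + s k)) \<bullet>
          (inverse (norm (y k)) *\<^sub>R (norm (y k) *\<^sub>R w - y k))" by simp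
      also have "\<dots> = (polymap P (y k) /\<^sub>R norm (y k) ^ ?d + (inverse (norm (y k)) ^ ?d) *\<^sub>R s k) \<bullet>
          (w - y k /\<^sub>R norm (y k))"
        using ynz[of k] by (simp add: scaleR_diff_right scaleR_add_right power_inverse)
      finally show ?thesis .
    qed
    from tendsto_lowerbound[OF main always_eventually[OF allI[OF this]] sequentially_bot]
    show ?thesis by simp
  qed
  have "v \<in> SOL (asymptotic_cone K) ?L" unfolding SOL_def using v pos by simp
  moreover have "v \<noteq> 0" using vr(1) by auto
  ultimately have "p \<bullet> v > 0" using inner_pos_of_interior_dual_cone[OF p] by blast
  moreover have "p \<bullet> v \<le> 0"
  proof (rule tendsto_upperbound)
    show "(\<lambda>k. s k \<bullet> (y k /\<^sub>R norm (y k))) \<longlonglongrightarrow> p \<bullet> v" by (intro tendsto_inner s dir)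
    show "\<forall>\<^sub>F k in sequentially. s k \<bullet> (y k /\<^sub>R norm (y k)) \<le> 0"
    proof (rule always_eventually, rule allI)
      fix k
      have "polymap P (y k) \<bullet> y k \<ge> 0" using cop y(1) by (simp add: copositive_on_def)
      moreover have "(polymap P (y k) + s k) \<bullet> y k \<le> 0" using y(2)[OF K(3), of k] by simp
      ultimately have "s k \<bullet> y k \<le> 0" by (simp add: inner_add_left)
      then show "s k \<bullet> (y k /\<^sub>R norm (y k)) \<le> 0"
        using ynz[of k] by (simp add: mult_nonneg_nonpos)
    qed
  qed simp
  ultimately show False by simp
qed

section \<open>From upper semicontinuity to Hoelder stability\<close>

text \<open>
  Solutions for parameters tending to \<open>p\<close> are bounded and accumulate only at
  solutions for \<open>p\<close>. If there are no solutions for \<open>p\<close>, this says that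
  there are none for parameters near \<open>p\<close>.
\<close>
lemma SOL_upper_semicontinuous:
  fixes K :: "(real ^ 'n::finite) set" and P :: "'n rpoly ^ 'n"
  assumes "closed K" "r > 0"
    and bound: "\<And>q x. q \<in> ball p r \<Longrightarrow> x \<in> SOL K (\<lambda>x. polymap P x + q) \<Longrightarrow> norm x \<le> R"
    and "\<epsilon> > 0"
  shows "\<exists>\<delta>>0. \<forall>q\<in>ball p \<delta>. \<forall>x\<in>SOL K (\<lambda>x. polymap P x + q).
    \<exists>z\<in>SOL K (\<lambda>x. polymap P x + p). dist x z < \<epsilon>"
proof (rule ccontr)
  assume contra: "\<not> ?thesis"
  have "\<exists>q x. dist p q < min r (1 / real (Suc k)) \<and> x \<in> SOL K (\<lambda>x. polymap P x + q) \<and>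
      (\<forall>z\<in>SOL K (\<lambda>x. polymap P x + p). \<epsilon> \<le> dist x z)" for k
  proof -
    have "min r (1 / real (Suc k)) > 0" using assms(2) by simp
    then have "\<not> (\<forall>q\<in>ball p (min r (1 / real (Suc k))). \<forall>x\<in>SOL K (\<lambda>x. polymap P x + q).
        \<exists>z\<in>SOL K (\<lambda>x. polymap P x + p). dist x z < \<epsilon>)"
      using contra by blast
    then show ?thesis unfolding not_less[symmetric] mem_ball[symmetric] by blast
  qed
  then obtain q x where qx: "\<And>k. dist p (q k) < min r (1 / real (Suc k))"
    "\<And>k. x k \<in> SOL K (\<lambda>x. polymap P x + q k)"
    "\<And>k. \<forall>z\<in>SOL K (\<lambda>x. polymap P x + p). \<epsilon> \<le> dist (x k) z" by metis
  have "\<forall>k. x k \<in> cball 0 R" using bound[OF _ qx(2)] qx(1) by simp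
  then obtain v f where vf: "strict_mono f" "(x \<circ> f) \<longlonglongrightarrow> v"
    using compact_cball[of "0 :: real ^ 'n" R] unfolding compact_def by meson
  have "q \<longlonglongrightarrow> p"
  proof (rule metric_LIMSEQ_I)
    fix e :: real assume "e > 0"
    then obtain N where N: "1 / real (Suc N) < e" by (rule nat_approx_posE)
    have "dist (q k) p < e" if "k \<ge> N" for k
    proof -
      have "1 / real (Suc k) \<le> 1 / real (Suc N)" using that by (simp add: frac_le)
      with N qx(1)[of k] show ?thesis by (simp add: dist_commute)
    qed
    then show "\<exists>N. \<forall>k\<ge>N. dist (q k) p < e" by blast
  qed
  then have "(q \<circ> f) \<longlonglongrightarrow> p" by (rule LIMSEQ_subseq_LIMSEQ[OF _ vf(1)])
  then have "v \<in> SOL K (\<lambda>x. polymap P x + p)"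
    by (rule SOL_limit[OF assms(1) vf(2)]) (use qx(2) in simp)
  then have "\<epsilon> \<le> dist (x (f k)) v" for k using qx(3) by blast
  moreover obtain k where "dist (x (f k)) v < \<epsilon>"
    using metric_LIMSEQ_D[OF vf(2) assms(4)] by auto
  ultimately show False by (meson not_le)
qed

lemma definable_SOL:
  fixes K :: "(real ^ 'n::finite) set" and u w :: "'n env \<Rightarrow> real ^ 'n"
  assumes "semialgebraic K" "poly_vector u" "poly_vector w"
    and "\<And>y e. u (set_block k y e) = u e" "\<And>y e. w (set_block k y e) = w e"
  shows "definable (\<lambda>e. u e \<in> SOL K (\<lambda>x. polymap P x + w e))"
proof -
  define \<psi> where "\<psi> = (\<lambda>e. block k e \<in> K \<longrightarrow> (polymap P (u e) + w e) \<bullet> (block k e - u e) \<ge> 0)"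
  have "definable \<psi>"
    unfolding \<psi>_def
    by (intro definable_imp definable_mem_semialgebraic[OF assms(1)] definable_nonneg
        poly_functions_inner poly_vector_add poly_vector_diff poly_vector_polymap
        poly_vector_block assms(2,3))
  then have "definable (\<lambda>e. u e \<in> K \<and> (\<forall>y. \<psi> (set_block k y e)))"
    by (intro definable_conj definable_all_block definable_mem_semialgebraic assms(1,2))
  then show ?thesis by (simp add: \<psi>_def SOL_def assms(4,5) Ball_def)
qed

text \<open>
  Variable \<open>(0, i)\<close> bounds the squared distance to the solutions for \<open>p\<close>
  from below, variable \<open>(1, i)\<close> the squared distance of the parameter to
  \<open>p\<close> from above; squares keep both polynomial. The bound variables \<open>x\<close>,
  \<open>q\<close>, \<open>z\<close> use the blocks 2, 3, 4, and block 5 is the test point in the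
  variational inequality.
\<close>
lemma SOL_semicontinuity_failure_definable:
  fixes K :: "(real ^ 'n::finite) set" and P :: "'n rpoly ^ 'n"
  assumes "semialgebraic K"
  shows "definable (\<lambda>e :: 'n env. \<exists>x q. norm (q - p) ^ 2 \<le> e (1, i) \<and> x \<in> SOL K (\<lambda>x. polymap P x + q) \<and>
    (\<forall>z\<in>SOL K (\<lambda>x. polymap P x + p). e (0, i) \<le> norm (x - z) ^ 2))"
proof -
  define \<phi>3 where "\<phi>3 = (\<lambda>e :: 'n env. block 4 e \<in> SOL K (\<lambda>x. polymap P x + p) \<longrightarrow>
    (block 2 e - block 4 e) \<bullet> (block 2 e - block 4 e) - e (0, i) \<ge> 0)"
  define \<phi>2 where "\<phi>2 = (\<lambda>e :: 'n env. e (1, i) - (block 3 e - p) \<bullet> (block 3 e - p) \<ge> 0 \<and>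
    (block 2 e \<in> SOL K (\<lambda>x. polymap P x + block 3 e) \<and> (\<forall>z. \<phi>3 (set_block 4 z e))))"
  note polys = poly_functions_diff poly_functions_inner poly_vector_diff poly_vector_block
    poly_vector_const poly_functions.var
  have 3: "definable \<phi>3"
    unfolding \<phi>3_def
    by (intro definable_imp definable_nonneg polys definable_SOL[where k = 5 and w = "\<lambda>e. p"] assms) simp_all
  have 2: "definable \<phi>2"
    unfolding \<phi>2_def
    by (intro definable_conj definable_nonneg polys definable_SOL[where k = 5] definable_all_block 3 assms)
      simp_all
  have "definable (\<lambda>e. \<exists>x. \<exists>q. \<phi>2 (set_block 3 q (set_block 2 x e)))"
    by (rule definable_ex_block[OF definable_ex_block[OF 2]])
  moreover have "\<phi>2 (set_block 3 q (set_block 2 x e)) \<longleftrightarrow>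
      norm (q - p) ^ 2 \<le> e (1, i) \<and> x \<in> SOL K (\<lambda>x. polymap P x + q) \<and>
      (\<forall>z\<in>SOL K (\<lambda>x. polymap P x + p). e (0, i) \<le> norm (x - z) ^ 2)" for q x e
    by (simp add: \<phi>2_def \<phi>3_def Ball_def power2_norm_eq_inner) (simp add: set_block_def)
  ultimately show ?thesis by simp
qed

text \<open>
  Let \<open>G s t\<close> say that some solution for a parameter within squared distance
  \<open>t\<close> of \<open>p\<close> has squared distance at least \<open>s\<close> to all
  solutions for \<open>p\<close>. This relation is semialgebraic, so it is constant on some
  corner, and upper semicontinuity makes it false for fixed \<open>s\<close> and small
  \<open>t\<close>. Hence it is false on the whole corner: \<open>s\<close> is bounded by a power
  of \<open>t\<close>.
\<close>
lemma SOL_hoelder_of_upper_semicontinuous: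
  fixes K :: "(real ^ 'n::finite) set" and P :: "'n rpoly ^ 'n"
  assumes "semialgebraic K"
    and usc: "\<And>\<epsilon>. \<epsilon> > 0 \<Longrightarrow> \<exists>\<delta>>0. \<forall>q\<in>ball p \<delta>. \<forall>x\<in>SOL K (\<lambda>x. polymap P x + q).
      \<exists>z\<in>SOL K (\<lambda>x. polymap P x + p). dist x z < \<epsilon>"
  shows "locally_upper_Hoelder_stable (\<lambda>q. SOL K (\<lambda>x. polymap P x + q)) p"
proof -
  define G where "G = (\<lambda>s t. \<exists>x q. norm (q - p) ^ 2 \<le> t \<and> x \<in> SOL K (\<lambda>x. polymap P x + q) \<and>
    (\<forall>z\<in>SOL K (\<lambda>x. polymap P x + p). s \<le> norm (x - z) ^ 2))"
  obtain i :: 'n where True by simp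
  define \<phi> where "\<phi> = (\<lambda>e :: 'n env. G (e (0, i)) (e (1, i)))"
  have "definable \<phi>"
    unfolding \<phi>_def G_def by (rule SOL_semicontinuity_failure_definable[OF assms(1)])
  moreover have "(0, i) \<noteq> (1 :: nat, i)" by simp
  ultimately have "\<exists>N>0. \<forall>(s, t)\<in>corner N. \<forall>(s', t')\<in>corner N.
      \<phi> ((\<lambda>_. 0)((0, i) := s, (1, i) := t)) = \<phi> ((\<lambda>_. 0)((0, i) := s', (1, i) := t'))"
    by (rule definable_constant_on_corner)
  then obtain N where N0: "N > 0" "\<forall>(s, t)\<in>corner N. \<forall>(s', t')\<in>corner N. G s t = G s' t'"
    by (auto simp: \<phi>_def)
  then have N: "N > 0" "\<And>s t s' t'. (s, t) \<in> corner N \<Longrightarrow> (s', t') \<in> corner N \<Longrightarrow> G s t = G s' t'"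
    by blast+
  have notG: "\<not> G s t" if st: "(s, t) \<in> corner N" for s t
  proof
    assume "G s t"
    have s: "0 < s" "0 < t" "s < 1 / real N" "t < s ^ N" using st by (auto simp: corner_def)
    then have "sqrt s > 0" by simp
    from usc[OF this] obtain \<delta> where \<delta>: "\<delta> > 0" "\<forall>q\<in>ball p \<delta>. \<forall>x\<in>SOL K (\<lambda>x. polymap P x + q).
      \<exists>z\<in>SOL K (\<lambda>x. polymap P x + p). dist x z < sqrt s" by blast
    \<comment> \<open>Lowering t stays inside the corner and brings the parameter within distance delta of p.\<close>
    define t' where "t' = min t (\<delta>\<^sup>2 / 4)"
    have "(s, t') \<in> corner N" using s \<delta>(1) by (auto simp: corner_def t'_def min_def)
    with N(2)[OF st] \<open>G s t\<close> have "G s t'" by blast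
    then obtain x q where xq: "norm (q - p) ^ 2 \<le> t'" "x \<in> SOL K (\<lambda>x. polymap P x + q)"
      "\<forall>z\<in>SOL K (\<lambda>x. polymap P x + p). s \<le> norm (x - z) ^ 2" unfolding G_def by blast
    have "t' \<le> (\<delta> / 2)\<^sup>2" by (simp add: t'_def power_divide)
    with xq(1) have "norm (q - p) ^ 2 \<le> (\<delta> / 2)\<^sup>2" by (rule order_trans)
    moreover have "\<delta> / 2 \<ge> 0" using \<delta>(1) by simp
    ultimately have "norm (q - p) \<le> \<delta> / 2" by (rule power2_le_imp_le)
    then have "q \<in> ball p \<delta>" using \<delta>(1) by (simp add: dist_norm norm_minus_commute)
    with \<delta>(2) xq(2) obtain z where z: "z \<in> SOL K (\<lambda>x. polymap P x + p)" "dist x z < sqrt s" by blast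
    have "norm (x - z) ^ 2 < (sqrt s)\<^sup>2"
      using z(2) by (intro power_strict_mono) (simp_all add: dist_norm)
    then have "norm (x - z) ^ 2 < s" using s(1) by simp
    with xq(3) z(1) show False by (meson not_le)
  qed
  define c where "c = 1 / real N"
  \<comment> \<open>Chosen so that 4 h powr (2 / N) stays below 1 / N for h < r, as the corner requires.\<close>
  define r where "r = (1 / (8 * real N)) powr (real N / 2)"
  have c: "c > 0" and r: "r > 0" using N(1) by (simp_all add: c_def r_def)
  have "SOL K (\<lambda>x. polymap P x + q) \<subseteq>
      {x + (2 * norm (q - p) powr c) *\<^sub>R b | x b. x \<in> SOL K (\<lambda>x. polymap P x + p) \<and> b \<in> cball 0 1}"
    if "q \<in> ball p r" for q
  proof
    fix x assume x: "x \<in> SOL K (\<lambda>x. polymap P x + q)"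
    show "x \<in> {x + (2 * norm (q - p) powr c) *\<^sub>R b | x b.
        x \<in> SOL K (\<lambda>x. polymap P x + p) \<and> b \<in> cball 0 1}"
    proof (cases "q = p")
      case True
      then have "x = x + (2 * norm (q - p) powr c) *\<^sub>R 0" by simp
      moreover have "x \<in> SOL K (\<lambda>x. polymap P x + p)" using x True by simp
      moreover have "0 \<in> cball (0 :: real ^ 'n) 1" by simp
      ultimately show ?thesis by blast
    next
      case False
      define h where "h = norm (q - p)"
      \<comment> \<open>The factor 2 makes the N-th power of the squared rho exceed the squared h strictly.\<close>
      define \<rho> where "\<rho> = 2 * h powr c"
      have h: "0 < h" "h < r" using False that by (simp_all add: h_def dist_norm norm_minus_commute)
      have \<rho>: "\<rho> > 0" using h(1) by (simp add: \<rho>_def)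
      have "h powr (2 / real N) < r powr (2 / real N)"
        using h N(1) by (intro powr_less_mono2) simp_all
      also have "\<dots> = 1 / (8 * real N)" using N(1) by (simp add: r_def powr_powr)
      finally have hr: "h powr (2 / real N) < 1 / (8 * real N)" .
      have sq: "\<rho>\<^sup>2 = 4 * h powr (2 / real N)"
        by (simp add: \<rho>_def power_mult_distrib c_def powr_powr flip: powr_numeral)
      have "4 * h powr (2 / real N) < 4 * (1 / (8 * real N))" by (rule mult_strict_left_mono[OF hr]) simp
      moreover have "4 * (1 / (8 * real N)) < 1 / real N" using N(1) by (simp add: divide_simps)
      ultimately have "\<rho>\<^sup>2 < 1 / real N" unfolding sq by (rule order_less_trans)
      moreover have "h\<^sup>2 < (\<rho>\<^sup>2) ^ N"
      proof -
        have "(h powr (2 / real N)) ^ N = h\<^sup>2"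
          using h(1) N(1) by (simp add: powr_power)
        then have "(\<rho>\<^sup>2) ^ N = 4 ^ N * h\<^sup>2" unfolding sq by (simp add: power_mult_distrib)
        moreover have "(1 :: real) < 4 ^ N" using N(1) by simp
        ultimately show ?thesis using h(1) by simp
      qed
      ultimately have "(\<rho>\<^sup>2, h\<^sup>2) \<in> corner N" using h(1) \<rho> by (simp add: corner_def)
      from notG[OF this] x obtain z where z: "z \<in> SOL K (\<lambda>x. polymap P x + p)" "norm (x - z) ^ 2 < \<rho>\<^sup>2"
        unfolding G_def h_def by (meson not_le order_refl)
      have "norm (x - z) \<le> \<rho>" by (rule power2_le_imp_le[OF less_imp_le[OF z(2)] less_imp_le[OF \<rho>]])
      then have "(1 / \<rho>) *\<^sub>R (x - z) \<in> cball 0 1" using \<rho> by simp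
      moreover have "x = z + \<rho> *\<^sub>R ((1 / \<rho>) *\<^sub>R (x - z))" using \<rho> by simp
      ultimately show ?thesis using z(1) unfolding \<rho>_def h_def by blast
    qed
  qed
  then show ?thesis
    unfolding locally_upper_Hoelder_stable_def
    by (intro exI[of _ 2] exI[of _ c] exI[of _ "ball p r"] conjI ballI) (use c r in simp_all)
qed

theorem proposition4p2:
  fixes K :: "(real ^ 'n::finite) set"
    and P :: "'n rpoly ^ 'n"
    and d :: nat
    and \<S> :: "(real ^ 'n) set"
    and p :: "real ^ 'n"
  assumes "K \<noteq> {}" and "closed K" and "convex K"
    and "polymap_degree P = d" and "d > 0"
    and "\<S> = SOL (asymptotic_cone K) (polymap (leading_part P))"
    and "semialgebraic K"
    and "0 \<in> K"
    and "copositive_on K (polymap P)"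
    and "p \<in> interior (dual_cone \<S>)"
  shows "locally_upper_Hoelder_stable (\<lambda>q. SOL K (\<lambda>x. polymap P x + q)) p"
proof -
  have "polymap_degree P > 0"
    and "p \<in> interior (dual_cone (SOL (asymptotic_cone K) (polymap (leading_part P))))"
    using assms by simp_all
  from SOL_locally_bounded[OF \<open>closed K\<close> \<open>convex K\<close> \<open>0 \<in> K\<close> this(1) \<open>copositive_on K (polymap P)\<close> this(2)]
  obtain r R where rR: "r > 0"
    "\<forall>q\<in>ball p r. \<forall>x\<in>SOL K (\<lambda>x. polymap P x + q). norm x \<le> R" by (elim exE conjE)
  show ?thesis
  proof (rule SOL_hoelder_of_upper_semicontinuous[OF \<open>semialgebraic K\<close>])
    fix \<epsilon> :: real assume "\<epsilon> > 0"
    show "\<exists>\<delta>>0. \<forall>q\<in>ball p \<delta>. \<forall>x\<in>SOL K (\<lambda>x. polymap P x + q).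
      \<exists>z\<in>SOL K (\<lambda>x. polymap P x + p). dist x z < \<epsilon>"
      by (rule SOL_upper_semicontinuous[OF \<open>closed K\<close> rR(1) _ \<open>\<epsilon> > 0\<close>]) (use rR(2) in blast)
  qed
qed

end
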